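(* Let $G=\mathbb{R}^{2n}\times\mathbb{R}^m$ be an H-type group and let $d(x,z)$ be the Carnot–Carathéodory distance from the identity $(0,0)$ to $(x,z)\in G$. Define $$\nu(\theta)=\frac{2\theta-\sin2\theta}{1-\cos2\theta}=\frac{\theta}{\sin^2\theta}-\cot\theta=-\frac{d}{d\theta}[\theta\cot\theta],\qquad \nu(0)=0.$$ Then $$d(x,z)=\begin{cases}|x|\,\dfrac{\theta}{\sin\theta}, & z\ne0,\ x\neq0,\\ |x|, & z=0,\\ \sqrt{4\pi|z|}, & x=0,\end{cases}$$ where, in the first case, $\theta$ is the unique solution in $[0,\pi)$ of $\nu(\theta)=\dfrac{4|z|}{|x|^2}$.
   Context: H-type groups: a finite-dimensional real Lie algebra $\mathfrak g$ with center $\mathfrak z\neq0$ is of H-type if it carries an inner product such that $[\mathfrak z^\perp,\mathfrak z^\perp]=\mathfrak z$ and, for each $z\in\mathfrak z$, the linear map $J_z:\mathfrak z^\perp\to\mathfrak z^\perp$ defined by $\langle J_zx,y\rangle=\langle z,[x,y]\rangle$ is orthogonal whenever $\langle z,z\rangle=1$. An H-type group is a connected simply connected Lie group with such a Lie algebra. Write $\dim\mathfrak z^\perp=2n$, $\dim\mathfrak z=m$. One realizes $G$ as $\mathbb{R}^{2n}\times\mathbb{R}^m$ with points $(x,z)$, where $\mathfrak z^\perp=\mathbb{R}^{2n}$, $\mathfrak z=\mathbb{R}^m$ carry the Euclidean inner product, $[\cdot,\cdot]:\mathbb{R}^{2n}\times\mathbb{R}^{2n}\to\mathbb{R}^m$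 is the bracket, and the group law is $(x,z)\circ(x',z')=(x+x',\,z+z'+\tfrac12[x,x'])$; the identity is $(0,0)$. With $e_i$, $u_j$ the standard bases of $\mathbb{R}^{2n}$, $\mathbb{R}^m$, let $X_i=\frac{\partial}{\partial x^i}+\frac12\sum_j\langle J_{u_j}x,e_i\rangle\frac{\partial}{\partial z^j}$, $i=1,\dots,2n$ (left-invariant vector fields). Distance: an absolutely continuous path $\gamma:[0,1]\to G$ is horizontal if $\dot\gamma(t)\in\mathrm{span}\{X_i(\gamma(t))\}$ for a.e. $t$; its length is $\int_0^1\|\dot\gamma(t)\|dt$, where $\|\cdot\|$ is the norm for which $X_1,\dots,X_{2n}$ are orthonormal. $d(x,z)$ is the infimum of lengths of horizontal paths from $(0,0)$ to $(x,z)$. *)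

theory Defs
  imports "HOL-Analysis.Analysis"
begin

section \<open>H-type Lie algebras\<close>

definition lie_bracket :: "('a::real_vector \<Rightarrow> 'a \<Rightarrow> 'a) \<Rightarrow> bool" where
  "lie_bracket br \<longleftrightarrow> bilinear br \<and> (\<forall>x. br x x = 0) \<and>
     (\<forall>x y z. br x (br y z) + br y (br z x) + br z (br x y) = 0)"

definition lie_center :: "('a::real_vector \<Rightarrow> 'a \<Rightarrow> 'a) \<Rightarrow> 'a set" where
  "lie_center br = {z. \<forall>x. br z x = 0}"

definition J_map :: "('a::euclidean_space \<Rightarrow> 'a \<Rightarrow> 'a) \<Rightarrow> 'a \<Rightarrow> 'a \<Rightarrow> 'a" where
  "J_map br z x = (THE w. w \<in> (lie_center br)\<^sup>\<bottom> \<and>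
      (\<forall>y\<in>(lie_center br)\<^sup>\<bottom>. w \<bullet> y = z \<bullet> br x y))"

text \<open>The inner product is that of the type. \<^const>\<open>orthogonal_transformation\<close> speaks about maps
  of a whole type, so orthogonality of \<open>J_map br z\<close> on the subspace \<open>(lie_center br)\<^sup>\<bottom>\<close> is
  spelled out; linearity of \<open>J_map br z\<close> there is automatic.\<close>

definition H_type_algebra :: "('a::euclidean_space \<Rightarrow> 'a \<Rightarrow> 'a) \<Rightarrow> bool" where
  "H_type_algebra br \<longleftrightarrow> lie_bracket br \<and> lie_center br \<noteq> {0} \<and>
     span {br x y | x y. x \<in> (lie_center br)\<^sup>\<bottom> \<and> y \<in> (lie_center br)\<^sup>\<bottom>} = lie_center br \<and>
     (\<forall>z\<in>lie_center br. z \<bullet> z = 1 \<longrightarrow>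
        (\<forall>x\<in>(lie_center br)\<^sup>\<bottom>. \<forall>y\<in>(lie_center br)\<^sup>\<bottom>. J_map br z x \<bullet> J_map br z y = x \<bullet> y))"

section \<open>H-type groups in coordinates\<close>

text \<open>\<open>B\<close> is the bracket of horizontal vectors; it takes values in the centre, and
  \<open>step2_bracket B\<close> is the bracket of the whole Lie algebra.\<close>

definition step2_bracket ::
    "(real^'p \<Rightarrow> real^'p \<Rightarrow> real^'m) \<Rightarrow> (real^'p) \<times> (real^'m) \<Rightarrow> (real^'p) \<times> (real^'m)
      \<Rightarrow> (real^'p) \<times> (real^'m)" where
  "step2_bracket B v w = (0, B (fst v) (fst w))"

definition H_type_group :: "(real^'p \<Rightarrow> real^'p \<Rightarrow> real^'m) \<Rightarrow> bool" where
  "H_type_group B \<longleftrightarrow> H_type_algebra (step2_bracket B) \<and>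
     lie_center (step2_bracket B) = {0} \<times> UNIV"

definition group_mult ::
    "(real^'p \<Rightarrow> real^'p \<Rightarrow> real^'m) \<Rightarrow> (real^'p) \<times> (real^'m) \<Rightarrow> (real^'p) \<times> (real^'m)
      \<Rightarrow> (real^'p) \<times> (real^'m)" where
  "group_mult B v w = (fst v + fst w, snd v + snd w + (1/2) *\<^sub>R B (fst v) (fst w))"

text \<open>The vector field \<open>X\<^sub>i\<close>, with tangent vectors identified with elements of the vector space.\<close>

definition X_field ::
    "(real^'p \<Rightarrow> real^'p \<Rightarrow> real^'m) \<Rightarrow> 'p \<Rightarrow> (real^'p) \<times> (real^'m) \<Rightarrow> (real^'p) \<times> (real^'m)" where
  "X_field B i v = (axis i 1,
     (1/2) *\<^sub>R (\<Sum>j\<in>UNIV. (J_map (step2_bracket B) (0, axis j 1) (fst v, 0) \<bullet> (axis i 1, 0))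
                   *\<^sub>R axis j 1))"

text \<open>The \<open>X\<^sub>i\<close> are the left-invariant fields extending \<open>(e\<^sub>i, 0)\<close>.\<close>

lemma H_type_group_bilinear:
  assumes "H_type_group B"
  shows "bilinear B"
proof -
  have b: "bilinear (step2_bracket B)"
    using assms by (simp add: H_type_group_def H_type_algebra_def lie_bracket_def)
  have s: "B x y = snd (step2_bracket B (x, 0) (y, 0))" for x y
    by (simp add: step2_bracket_def)
  show ?thesis
    unfolding bilinear_def
  proof (intro conjI allI)
    fix x
    have "linear (\<lambda>y. snd (step2_bracket B (x, 0) (y, 0)))"
      using bilinear_radd[OF b, of "(x,0)" "(_,0)" "(_,0)"] bilinear_rmul[OF b, of "(x,0)" _ "(_,0)"]
      by (intro linearI) simp_all
    then show "linear (B x)" by (simp flip: s)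
    have "linear (\<lambda>y. snd (step2_bracket B (y, 0) (x, 0)))"
      using bilinear_ladd[OF b, of "(_,0)" "(_,0)" "(x,0)"] bilinear_lmul[OF b, of _ "(_,0)" "(x,0)"]
      by (intro linearI) simp_all
    then show "linear (\<lambda>y. B y x)" by (simp flip: s)
  qed
qed

lemma H_type_group_J_map:
  assumes "H_type_group B"
  shows "J_map (step2_bracket B) (0, u) (x, 0) \<bullet> (y, 0) = u \<bullet> B x y"
proof -
  have perp: "(lie_center (step2_bracket B))\<^sup>\<bottom> = UNIV \<times> {0}"
    using assms
    by (auto simp: H_type_group_def orthogonal_comp_def orthogonal_def)
       (metis inner_eq_zero_iff)
  have lin: "linear (B x)"
    using H_type_group_bilinear[OF assms] by (simp add: bilinear_def)
  have "J_map (step2_bracket B) (0, u) (x, 0) = (adjoint (B x) u, 0)"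
    unfolding J_map_def perp
  proof (rule the_equality)
    show "(adjoint (B x) u, 0) \<in> UNIV \<times> {0} \<and>
      (\<forall>y\<in>UNIV \<times> {0}. (adjoint (B x) u, 0) \<bullet> y = (0, u) \<bullet> step2_bracket B (x, 0) y)"
      by (auto simp: step2_bracket_def adjoint_works[OF lin] inner_commute)
  next
    fix w :: "(real^'a) \<times> (real^'b)"
    assume w: "w \<in> UNIV \<times> {0} \<and> (\<forall>y\<in>UNIV \<times> {0}. w \<bullet> y = (0, u) \<bullet> step2_bracket B (x, 0) y)"
    have "fst w \<bullet> y = adjoint (B x) u \<bullet> y" for y
    proof -
      have "w \<bullet> (y, 0) = (0, u) \<bullet> step2_bracket B (x, 0) (y, 0)" using w by blast
      then show ?thesis
        using w by (cases w) (simp add: step2_bracket_def adjoint_works[OF lin] inner_commute)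
    qed
    then have "fst w = adjoint (B x) u" using vector_eq_rdot by blast
    then show "w = (adjoint (B x) u, 0)" using w by (cases w) auto
  qed
  then show ?thesis
    by (simp add: adjoint_works[OF lin] inner_commute)
qed

lemma X_field_eq:
  assumes "H_type_group B"
  shows "X_field B i v = (axis i 1, (1/2) *\<^sub>R B (fst v) (axis i 1))"
  by (simp add: X_field_def H_type_group_J_map[OF assms] vec_eq_iff axis_def if_distrib
      if_distribR inner_vec_def cong: if_cong)

lemma X_field_left_invariant:
  assumes "H_type_group B"
  shows "((\<lambda>s. group_mult B v (s *\<^sub>R axis i 1, 0)) has_vector_derivative X_field B i v) (at 0)"
proof -
  have "B (fst v) (s *\<^sub>R axis i 1) = s *\<^sub>R B (fst v) (axis i 1)" for s
    using bilinear_rmul[OF H_type_group_bilinear[OF assms]] by blast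
  then show ?thesis
    unfolding X_field_eq[OF assms] group_mult_def
    by (auto intro!: derivative_eq_intros has_vector_derivative_Pair)
qed

section \<open>The Carnot--Caratheodory distance from the identity\<close>

text \<open>\<^const>\<open>absolutely_continuous\<close> in the library is about measures.\<close>

definition abs_continuous_on :: "real set \<Rightarrow> (real \<Rightarrow> 'a::real_normed_vector) \<Rightarrow> bool" where
  "abs_continuous_on I f \<longleftrightarrow> (\<forall>\<epsilon>>0. \<exists>\<delta>>0. \<forall>D. D division_of \<Union>D \<and> \<Union>D \<subseteq> I \<and>
      (\<Sum>K\<in>D. Sup K - Inf K) < \<delta> \<longrightarrow> (\<Sum>K\<in>D. norm (f (Sup K) - f (Inf K))) < \<epsilon>)"

definition horizontal_path ::
    "(real^'p \<Rightarrow> real^'p \<Rightarrow> real^'m) \<Rightarrow> (real \<Rightarrow> (real^'p) \<times> (real^'m)) \<Rightarrow> bool" where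
  "horizontal_path B \<gamma> \<longleftrightarrow> abs_continuous_on {0..1} \<gamma> \<and>
     (AE t in lebesgue_on {0..1}.
        \<exists>v \<in> span (range (\<lambda>i. X_field B i (\<gamma> t))). (\<gamma> has_vector_derivative v) (at t))"

text \<open>The norm on the span of the \<open>X\<^sub>i\<close> at \<open>q\<close> for which they are orthonormal; the coefficients
  are unique since the \<open>X\<^sub>i\<close> are linearly independent.\<close>

definition hor_norm ::
    "(real^'p \<Rightarrow> real^'p \<Rightarrow> real^'m) \<Rightarrow> (real^'p) \<times> (real^'m) \<Rightarrow> (real^'p) \<times> (real^'m) \<Rightarrow> real" where
  "hor_norm B q v = norm (THE a :: real^'p. v = (\<Sum>i\<in>UNIV. (a $ i) *\<^sub>R X_field B i q))"

text \<open>For a horizontal path the integrand is integrable, being almost everywhere the norm of the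
  derivative of an absolutely continuous function.\<close>

definition hor_length ::
    "(real^'p \<Rightarrow> real^'p \<Rightarrow> real^'m) \<Rightarrow> (real \<Rightarrow> (real^'p) \<times> (real^'m)) \<Rightarrow> real" where
  "hor_length B \<gamma> = integral {0..1} (\<lambda>t. hor_norm B (\<gamma> t) (vector_derivative \<gamma> (at t)))"

text \<open>Extended reals, so that the infimum over no paths would be \<open>\<infinity>\<close>.\<close>

definition cc_dist ::
    "(real^'p \<Rightarrow> real^'p \<Rightarrow> real^'m) \<Rightarrow> (real^'p) \<times> (real^'m) \<Rightarrow> ereal" where
  "cc_dist B q =
     (INF \<gamma> \<in> {\<gamma>. horizontal_path B \<gamma> \<and> \<gamma> 0 = (0, 0) \<and> \<gamma> 1 = q}. ereal (hor_length B \<gamma>))"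

definition nu :: "real \<Rightarrow> real" where
  "nu \<theta> = (if \<theta> = 0 then 0 else (2 * \<theta> - sin (2 * \<theta>)) / (1 - cos (2 * \<theta>)))"

end

theory Submission
  imports Defs "HOL-Real_Asymp.Real_Asymp"
begin

text \<open>
  With \<open>u = z / |z|\<close> and \<open>\<tau>\<close> the arc length of a horizontal path of length \<open>L\<close>, the function
  \<open>|x|\<^sup>2 \<phi>(\<tau>) + 4 \<theta> (u \<bullet> z) - K \<tau>\<close> decreases along the path as soon as \<open>\<phi>\<close> solves the Riccati
  equation \<open>\<phi>' = - (\<theta>\<^sup>2 + \<phi>\<^sup>2) / K\<close>; this is a completion of squares, using that \<open>J\<^sub>u\<close> is skew and
  orthogonal. The solution \<open>\<phi>(s) = \<theta> cot (\<theta> (s + \<epsilon>) / K)\<close> with \<open>K = L + \<epsilon>\<close>, \<open>\<epsilon> \<rightarrow> 0\<close>, yields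
  \<open>|x|\<^sup>2 \<theta> cot \<theta> + 4 \<theta> |z| \<le> L\<^sup>2\<close> for every \<open>0 < \<theta> < \<pi>\<close>. The supremum of the left-hand side over
  \<open>\<theta>\<close> is attained where \<open>\<nu>(\<theta>) = 4 |z| / |x|\<^sup>2\<close> (in the limit \<open>\<theta> \<rightarrow> \<pi>\<close> when \<open>x = 0\<close>), and a circular
  arc in the plane spanned by \<open>x\<close> and \<open>J\<^sub>u x\<close> realizes it.

  Working with increments up to \<open>O((\<Delta>\<tau>)\<^sup>2)\<close> avoids both the reparametrization by arc length and
  the Lebesgue differentiation of \<open>\<tau>\<close>.
\<close>

section \<open>Absolutely continuous functions\<close>

text \<open>Subintervals tagged in the null set \<open>N\<close> lie in an open set of small measure, so absolute
  continuity bounds their contribution; the other ones are controlled by differentiability.\<close>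

lemma abs_continuous_has_integral:
  fixes f :: "real \<Rightarrow> 'a::banach"
  assumes ab: "a \<le> b" and ac: "abs_continuous_on {a..b} f" and N: "negligible N"
    and f': "\<And>t. t \<in> {a..b} - N \<Longrightarrow> (f has_vector_derivative f' t) (at t within {a..b})"
  shows "(f' has_integral (f b - f a)) {a..b}"
proof -
  \<comment> \<open>\<open>g\<close> vanishes on \<open>N\<close>, so a tag in \<open>N\<close> adds
    nothing to the Riemann sum and its error is just the increment of \<open>f\<close>.\<close>
  define g where "g = (\<lambda>t. if t \<in> N then 0 else f' t)"
  have "(g has_integral (f b - f a)) {a..b}"
    unfolding has_integral_real
  proof (intro allI impI)
    fix e :: real assume e: "e > 0"
    \<comment> \<open>The \<open>+ 1\<close> keeps the quotient meaningful for \<open>a = b\<close>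
      and makes \<open>k * (b - a) < e / 2\<close> strict.\<close>
    define k where "k = e / (2 * (b - a + 1))"
    have k: "k > 0" "k * (b - a) < e / 2"
      using e ab by (auto simp: k_def field_simps)
    obtain d where d: "d > 0" and dD: "\<And>D. D division_of \<Union>D \<Longrightarrow> \<Union>D \<subseteq> {a..b} \<Longrightarrow>
        (\<Sum>K\<in>D. Sup K - Inf K) < d \<Longrightarrow> (\<Sum>K\<in>D. norm (f (Sup K) - f (Inf K))) < e / 2"
      using ac e unfolding abs_continuous_on_def by (meson half_gt_zero)
    have "N \<in> sets lebesgue" "emeasure lebesgue N = 0"
      using N by (auto simp: negligible_iff_null_sets)
    then obtain U where U: "open U" "N \<subseteq> U" and UN: "U - N \<in> lmeasurable" "emeasure lebesgue (U - N) < ennreal d"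
      using sets_lebesgue_outer_open[OF _ d] by metis
    have Um: "U \<in> lmeasurable"
      using measurable_Un_null_set[of N lebesgue "U - N"] UN(1) U(2) N
      by (metis Diff_partition Un_commute fmeasurable.Un negligible_imp_measurable)
    have "measure lebesgue U = measure lebesgue (U - N)"
      using N by (metis Diff_Diff_Int Un_Diff_Int measure_Diff_null_set UN(1) N negligible_iff_null_sets Um fmeasurableD)
    then have mU: "measure lebesgue U < d"
      using UN d by (simp add: emeasure_eq_measure2 fmeasurableD2 ennreal_less_iff)
    \<comment> \<open>Radius of the gauge at \<open>t\<close>: on \<open>N\<close> the ball stays
      inside the small open set \<open>U\<close>, elsewhere the linear approximation of
      \<open>f\<close> at \<open>t\<close> is accurate up to slope \<open>k\<close>.\<close>
    have "\<exists>r>0. if t \<in> N then ball t r \<subseteq> U else t \<in> {a..b} \<longrightarrow>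
        (\<forall>y\<in>{a..b}. \<bar>y - t\<bar> < r \<longrightarrow> norm (f y - f t - (y - t) *\<^sub>R f' t) \<le> k * \<bar>y - t\<bar>)" for t
    proof (cases "t \<in> N")
      case True
      then show ?thesis using U by (auto elim!: openE)
    next
      case False
      show ?thesis
      proof (cases "t \<in> {a..b}")
        case True
        then have "(f has_derivative (\<lambda>h. h *\<^sub>R f' t)) (at t within {a..b})"
          using f'[of t] False by (simp add: has_vector_derivative_def)
        then show ?thesis
          using False k(1) unfolding has_derivative_within_alt by auto
      qed (use False in \<open>auto intro: exI[of _ 1]\<close>)
    qed
    then obtain r where r: "\<And>t. r t > 0" and rN: "\<And>t. t \<in> N \<Longrightarrow> ball t (r t) \<subseteq> U"
      and rf: "\<And>t y. t \<in> {a..b} - N \<Longrightarrow> y \<in> {a..b} \<Longrightarrow> \<bar>y - t\<bar> < r t \<Longrightarrow>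
          norm (f y - f t - (y - t) *\<^sub>R f' t) \<le> k * \<bar>y - t\<bar>"
      by (metis DiffD1 DiffD2)
    show "\<exists>\<gamma>. gauge \<gamma> \<and> (\<forall>\<D>. \<D> tagged_division_of {a..b} \<and> \<gamma> fine \<D> \<longrightarrow>
        norm ((\<Sum>(x, k)\<in>\<D>. measure lborel k *\<^sub>R g x) - (f b - f a)) < e)"
    proof (intro exI conjI allI impI)
      show "gauge (\<lambda>t. ball t (r t))" using r by (simp add: gauge_def)
    next
      fix p assume "p tagged_division_of {a..b} \<and> (\<lambda>t. ball t (r t)) fine p"
      then have p: "p tagged_division_of {a..b}" and fine: "\<And>t K. (t, K) \<in> p \<Longrightarrow> K \<subseteq> ball t (r t)"
        by (auto simp: fine_def)
      note pD = tagged_division_ofD[OF p]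
      have interval: "\<exists>u v. K = {u..v} \<and> u \<le> t \<and> t \<le> v \<and> a \<le> u \<and> v \<le> b" if "(t, K) \<in> p" for t K
        using pD(2-4)[OF that] by (auto simp: box_real)
      define q where "q = {(t, K) \<in> p. t \<in> N}"
      have qp: "q \<subseteq> p" and fq: "finite q" using pD(1) by (auto simp: q_def intro: finite_subset)
      have "q tagged_partial_division_of {a..b}"
        using p qp tagged_partial_division_subset unfolding tagged_division_of_def by blast
      then have qt: "q tagged_division_of (\<Union>(snd ` q))"
        by (rule tagged_partial_division_of_Union_self)
      then have dq: "snd ` q division_of \<Union>(snd ` q)"
        by (rule division_of_tagged_division)
      have SI: "Sup K - Inf K = measure lborel K" if "(t, K) \<in> p" for t K
        using interval[OF that] by auto
      have "(\<Sum>K\<in>snd ` q. Sup K - Inf K) = (\<Sum>K\<in>snd ` q. measure lborel K)"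
        using SI qp by (intro sum.cong) auto
      also have "\<dots> = measure lebesgue (\<Union>(snd ` q))"
        using content_division[OF dq] interval qp by (subst sum.cong[OF refl, of _ _ "measure lebesgue"]) fastforce+
      also have "\<dots> \<le> measure lebesgue U"
      proof (rule measure_mono_fmeasurable)
        show "\<Union>(snd ` q) \<subseteq> U" using fine rN by (fastforce simp: q_def)
        show "\<Union>(snd ` q) \<in> sets lebesgue"
          using dq by (meson fmeasurableD lmeasurable_division)
      qed (rule Um)
      finally have "(\<Sum>K\<in>snd ` q. norm (f (Sup K) - f (Inf K))) < e / 2"
        using mU interval qp by (intro dD[OF dq]) fastforce+
      \<comment> \<open>The sum passes from intervals to tagged pairs. The reindexing lemma requires
        the summand to vanish on every \<open>cbox u v\<close> with empty interior; the guard
        settles the empty ones, where \<open>Sup\<close> and \<open>Inf\<close> carry no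
        information.\<close>
      also have "(\<Sum>K\<in>snd ` q. norm (f (Sup K) - f (Inf K)))
          = (\<Sum>K\<in>snd ` q. if K = {} then 0 else norm (f (Sup K) - f (Inf K)))"
        using interval qp by (intro sum.cong) fastforce+
      also have "\<dots> = (\<Sum>(t, K)\<in>q. if K = {} then 0 else norm (f (Sup K) - f (Inf K)))"
      proof (rule sum.over_tagged_division_lemma[OF qt, symmetric])
        fix u v :: real assume "box u v = {}"
        then have "v \<le> u" by simp
        then show "(if cbox u v = {} then 0 else norm (f (Sup (cbox u v)) - f (Inf (cbox u v)))) = 0"
          by (cases "u = v") auto
      qed
      also have "\<dots> = (\<Sum>(t, K)\<in>q. norm (f (Sup K) - f (Inf K)))"
        using interval qp by (intro sum.cong) fastforce+
      finally have A: "(\<Sum>(t, K)\<in>q. norm (f (Sup K) - f (Inf K))) < e / 2" .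
      \<comment> \<open>The increment over \<open>{u..v}\<close> is split at the tag
        \<open>t\<close>, where both halves are compared with the same derivative.\<close>
      have B: "norm (measure lborel K *\<^sub>R g t - (f (Sup K) - f (Inf K))) \<le> k * measure lborel K"
        if tK: "(t, K) \<in> p - q" for t K
      proof -
        obtain u v where uv: "K = {u..v}" "u \<le> t" "t \<le> v" "a \<le> u" "v \<le> b"
          using interval tK by blast
        have t: "t \<in> {a..b} - N" using uv tK by (auto simp: q_def)
        have "u \<in> K" "v \<in> K" using uv by auto
        then have "u \<in> ball t (r t)" "v \<in> ball t (r t)" using fine[of t K] tK by auto
        then have 1: "norm (f u - f t - (u - t) *\<^sub>R f' t) \<le> k * (t - u)"
             "norm (f v - f t - (v - t) *\<^sub>R f' t) \<le> k * (v - t)"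
          using rf[OF t, of u] rf[OF t, of v] uv by (auto simp: dist_real_def)
        have "measure lborel K *\<^sub>R g t - (f (Sup K) - f (Inf K))
            = (f u - f t - (u - t) *\<^sub>R f' t) - (f v - f t - (v - t) *\<^sub>R f' t)"
          using uv t by (simp add: g_def algebra_simps)
        also have "norm \<dots> \<le> k * (t - u) + k * (v - t)"
          using 1 norm_triangle_ineq4 by (meson add_mono order_trans)
        finally show ?thesis using uv by (simp add: algebra_simps)
      qed
      have "(\<Sum>(t, K)\<in>p. measure lborel K *\<^sub>R g t) - (f b - f a)
          = (\<Sum>(t, K)\<in>p. measure lborel K *\<^sub>R g t - (f (Sup K) - f (Inf K)))"
        using additive_tagged_division_1[OF ab p, of f] by (simp add: sum_subtractf split_def)
      also have "norm \<dots> \<le> (\<Sum>(t, K)\<in>p. norm (measure lborel K *\<^sub>R g t - (f (Sup K) - f (Inf K))))"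
        by (rule order_trans[OF norm_sum]) (simp add: split_def)
      also have "\<dots> = (\<Sum>(t, K)\<in>p - q. norm (measure lborel K *\<^sub>R g t - (f (Sup K) - f (Inf K))))
          + (\<Sum>(t, K)\<in>q. norm (measure lborel K *\<^sub>R g t - (f (Sup K) - f (Inf K))))"
        using qp pD(1) by (rule sum.subset_diff)
      also have "(\<Sum>(t, K)\<in>q. norm (measure lborel K *\<^sub>R g t - (f (Sup K) - f (Inf K))))
          = (\<Sum>(t, K)\<in>q. norm (f (Sup K) - f (Inf K)))"
        by (intro sum.cong refl) (auto simp: q_def g_def norm_minus_commute)
      also have "(\<Sum>(t, K)\<in>p - q. norm (measure lborel K *\<^sub>R g t - (f (Sup K) - f (Inf K))))
          \<le> (\<Sum>(t, K)\<in>p - q. k * measure lborel K)"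
        using B by (intro sum_mono) auto
      also have "\<dots> \<le> (\<Sum>(t, K)\<in>p. k * measure lborel K)"
        using pD(1) k by (intro sum_mono2) auto
      also have "\<dots> = k * (b - a)"
        using additive_content_tagged_division[of p a b] p ab
        by (simp add: sum_distrib_left[symmetric] split_def)
      finally show "norm ((\<Sum>(t, K)\<in>p. measure lborel K *\<^sub>R g t) - (f b - f a)) < e"
        using A k by linarith
    qed
  qed
  then show ?thesis
    using N by (rule has_integral_spike[rotated 2]) (auto simp: g_def)
qed

lemma abs_continuous_on_subset:
  "abs_continuous_on I f \<Longrightarrow> J \<subseteq> I \<Longrightarrow> abs_continuous_on J f"
  unfolding abs_continuous_on_def by (meson order_trans)

text \<open>The integral of the preceding lemma may be conditional, whereas arc length needs the
  norm of the derivative to be integrable. Absolute continuity bounds the variation of the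
  indefinite integral on short intervals, and finitely many of these cover
  \<open>{a..b}\<close>.\<close>

lemma abs_continuous_absolutely_integrable:
  fixes f :: "real \<Rightarrow> 'a::euclidean_space"
  assumes ac: "abs_continuous_on {a..b} f" and N: "negligible N"
    and f': "\<And>t. t \<in> {a..b} - N \<Longrightarrow> (f has_vector_derivative f' t) (at t within {a..b})"
  shows "f' absolutely_integrable_on {a..b}"
proof -
  obtain d where d: "d > 0" and dD: "\<And>D. D division_of \<Union>D \<Longrightarrow> \<Union>D \<subseteq> {a..b} \<Longrightarrow>
      (\<Sum>K\<in>D. Sup K - Inf K) < d \<Longrightarrow> (\<Sum>K\<in>D. norm (f (Sup K) - f (Inf K))) < 1"
    using ac unfolding abs_continuous_on_def by (meson zero_less_one)
  have int: "(f' has_integral (f v - f u)) {u..v}" if "a \<le> u" "u \<le> v" "v \<le> b" for u v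
  proof (rule abs_continuous_has_integral[OF _ _ N])
    have sub: "{u..v} \<subseteq> {a..b}" using that by auto
    show "abs_continuous_on {u..v} f" using abs_continuous_on_subset[OF ac sub] .
    show "(f has_vector_derivative f' t) (at t within {u..v})" if "t \<in> {u..v} - N" for t
      using has_vector_derivative_within_subset[OF f' sub] that sub by blast
  qed (use that in auto)
  \<comment> \<open>on an interval shorter than \<open>d\<close> the variation of \<open>f\<close> is at most 1\<close>
  have short: "f' absolutely_integrable_on {u..v}" if uv: "a \<le> u" "u \<le> v" "v \<le> b" "v - u < d" for u v
  proof -
    have "f' absolutely_integrable_on cbox u v"
    proof (rule bounded_variation_absolutely_integrable_interval)
      show "f' integrable_on cbox u v" using int[of u v] uv by (auto simp: box_real)
      show "(\<Sum>K\<in>D. norm (integral K f')) \<le> 1" if D: "D division_of cbox u v" for D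
      proof -
        have I: "\<exists>x y. K = {x..y} \<and> x \<le> y \<and> u \<le> x \<and> y \<le> v" if "K \<in> D" for K
          using division_ofD(2-4)[OF D that]
          by (metis atLeastatMost_empty_iff2 atLeastatMost_subset_iff box_real(2))
        have UD: "\<Union>D = {u..v}" using D by (auto simp: division_of_def box_real)
        have "(\<Sum>K\<in>D. Sup K - Inf K) = (\<Sum>K\<in>D. measure lborel K)"
          using I by (intro sum.cong) fastforce+
        also have "\<dots> = v - u" using additive_content_division[OF D] uv by simp
        finally have "(\<Sum>K\<in>D. norm (f (Sup K) - f (Inf K))) < 1"
          using D UD uv by (intro dD) (auto simp: box_real)
        also have "(\<Sum>K\<in>D. norm (f (Sup K) - f (Inf K))) = (\<Sum>K\<in>D. norm (integral K f'))"
        proof (rule sum.cong[OF refl])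
          fix K assume "K \<in> D"
          then obtain x y where "K = {x..y}" "x \<le> y" "u \<le> x" "y \<le> v" using I by blast
          then show "norm (f (Sup K) - f (Inf K)) = norm (integral K f')"
            using integral_unique[OF int[of x y]] uv by simp
        qed
        finally show ?thesis by simp
      qed
    qed
    then show ?thesis by (simp add: box_real)
  qed
  have "f' absolutely_integrable_on {a..b}" if "a \<le> b"
  proof -
    \<comment> \<open>Steps of \<open>d/2\<close> are strictly shorter than \<open>d\<close>;
      \<open>min b\<close> cuts off the last one.\<close>
    have *: "f' absolutely_integrable_on {a..min b (a + real n * (d/2))}" for n
    proof (induction n)
      case 0
      show ?case using that short[of a a] d by simp
    next
      case (Suc n)
      let ?c = "min b (a + real n * (d/2))" and ?c' = "min b (a + real (Suc n) * (d/2))"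
      have "real (Suc n) * (d/2) = real n * (d/2) + d/2" "0 \<le> real n * (d/2)"
        using d by (simp_all add: algebra_simps)
      then have o: "a \<le> ?c" "?c \<le> ?c'" "?c' \<le> b" "?c' - ?c < d"
        using that d by linarith+
      then have "{a..?c'} = {a..?c} \<union> {?c..?c'}"
        using ivl_disj_un_two_touch(4)[OF o(1,2)] by simp
      then show ?case
        using absolutely_integrable_Un[OF Suc short[OF o]] by metis
    qed
    obtain n where "real n * (d/2) \<ge> b - a"
      using reals_Archimedean3[of "d/2"] d by (meson half_gt_zero less_imp_le)
    then show ?thesis using *[of n] by (simp add: min_def split: if_splits)
  qed
  then show ?thesis by (cases "a \<le> b") auto
qed

section \<open>Horizontal vectors in an H-type algebra\<close>

text \<open>This is \<open>J_map\<close> on horizontal vectors (\<open>J_map_eq_J_hor\<close>),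
  given by an adjoint instead of a definite description on pairs.\<close>

definition J_hor :: "(real^'p \<Rightarrow> real^'p \<Rightarrow> real^'m) \<Rightarrow> real^'m \<Rightarrow> real^'p \<Rightarrow> real^'p" where
  "J_hor B u \<xi> = adjoint (B \<xi>) u"

context
  fixes B :: "real^'p \<Rightarrow> real^'p \<Rightarrow> real^'m"
  assumes H: "H_type_group B"
begin

lemma bilinear_B: "bilinear B"
  using H_type_group_bilinear[OF H] .

lemma linear_B: "linear (B \<xi>)"
  using bilinear_B by (simp add: bilinear_def)

lemma inner_J_hor: "J_hor B u \<xi> \<bullet> \<eta> = u \<bullet> B \<xi> \<eta>"
  by (simp add: J_hor_def adjoint_works[OF linear_B] inner_commute)

lemma B_self: "B \<xi> \<xi> = 0"
proof -
  have "step2_bracket B (\<xi>, 0) (\<xi>, 0) = 0"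
    using H unfolding H_type_group_def H_type_algebra_def lie_bracket_def by blast
  then show ?thesis by (simp add: step2_bracket_def zero_prod_def)
qed

lemma B_swap: "B \<eta> \<xi> = - B \<xi> \<eta>"
proof -
  have "B \<xi> \<eta> + B \<eta> \<xi> = 0"
    using B_self[of "\<xi> + \<eta>"] B_self[of \<xi>] B_self[of \<eta>]
    by (simp add: bilinear_ladd[OF bilinear_B] bilinear_radd[OF bilinear_B] add.commute)
  then show ?thesis by (simp add: eq_neg_iff_add_eq_0 add.commute)
qed

lemma J_hor_self: "J_hor B u \<xi> \<bullet> \<xi> = 0"
  by (simp add: inner_J_hor B_self)

lemma center_orthogonal_comp: "(lie_center (step2_bracket B))\<^sup>\<bottom> = UNIV \<times> {0}"
  using H by (auto simp: H_type_group_def orthogonal_comp_def orthogonal_def)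
    (metis inner_eq_zero_iff)

lemma J_map_eq_J_hor: "J_map (step2_bracket B) (0, u) (\<xi>, 0) = (J_hor B u \<xi>, 0)"
  unfolding J_map_def center_orthogonal_comp
proof (rule the_equality)
  show "(J_hor B u \<xi>, 0) \<in> UNIV \<times> {0} \<and>
    (\<forall>y\<in>UNIV \<times> {0}. (J_hor B u \<xi>, 0) \<bullet> y = (0, u) \<bullet> step2_bracket B (\<xi>, 0) y)"
    by (auto simp: step2_bracket_def inner_J_hor)
next
  fix w :: "(real^'p) \<times> (real^'m)"
  assume w: "w \<in> UNIV \<times> {0} \<and> (\<forall>y\<in>UNIV \<times> {0}. w \<bullet> y = (0, u) \<bullet> step2_bracket B (\<xi>, 0) y)"
  then obtain a where a: "w = (a, 0)" by auto
  have "a \<bullet> y = J_hor B u \<xi> \<bullet> y" for y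
    using w[THEN conjunct2, rule_format, of "(y, 0)"] by (simp add: a step2_bracket_def inner_J_hor)
  then show "w = (J_hor B u \<xi>, 0)" using a vector_eq_rdot by blast
qed

section \<open>Clifford relations between the maps \<open>J_hor B u\<close>\<close>

lemma J_hor_orthogonal:
  assumes "norm u = 1"
  shows "J_hor B u \<xi> \<bullet> J_hor B u \<eta> = \<xi> \<bullet> \<eta>"
proof -
  have "(0, u) \<in> lie_center (step2_bracket B)"
    using H by (simp add: H_type_group_def)
  moreover have "(0::real^'p, u) \<bullet> (0, u) = 1"
    using assms by (simp add: dot_square_norm)
  ultimately have "J_map (step2_bracket B) (0, u) (\<xi>, 0) \<bullet> J_map (step2_bracket B) (0, u) (\<eta>, 0)
      = (\<xi>, 0::real^'m) \<bullet> (\<eta>, 0)"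
    using H unfolding H_type_group_def H_type_algebra_def center_orthogonal_comp by blast
  then show ?thesis by (simp add: J_map_eq_J_hor)
qed

lemma J_hor_scaleR: "J_hor B (c *\<^sub>R u) \<xi> = c *\<^sub>R J_hor B u \<xi>"
  by (simp add: J_hor_def linear_scale[OF adjoint_linear[OF linear_B]])

lemma J_hor_add: "J_hor B (u + v) \<xi> = J_hor B u \<xi> + J_hor B v \<xi>"
  by (simp add: J_hor_def linear_add[OF adjoint_linear[OF linear_B]])

lemma J_hor_inner_self: "J_hor B u \<xi> \<bullet> J_hor B u \<xi> = (u \<bullet> u) * (\<xi> \<bullet> \<xi>)"
proof (cases "u = 0")
  case False
  define v where "v = (1 / norm u) *\<^sub>R u"
  have "norm v = 1" "u = norm u *\<^sub>R v" using False by (auto simp: v_def)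
  then show ?thesis
    using J_hor_orthogonal[of v \<xi> \<xi>] J_hor_scaleR[of "norm u" v \<xi>]
    by (metis (no_types, lifting) inner_scaleR_left inner_scaleR_right dot_square_norm mult.assoc
        mult_1 power2_eq_square power_one)
qed (use J_hor_scaleR[of 0 0 \<xi>] in simp)

text \<open>Polarization in \<open>u\<close> of the preceding identity.\<close>

lemma J_hor_inner_J_hor: "J_hor B u \<xi> \<bullet> J_hor B v \<xi> = (u \<bullet> v) * (\<xi> \<bullet> \<xi>)"
  using J_hor_inner_self[of "u + v" \<xi>] J_hor_inner_self[of u \<xi>] J_hor_inner_self[of v \<xi>]
  by (simp add: J_hor_add inner_add_left inner_add_right inner_commute algebra_simps)

text \<open>Pairing with an arbitrary \<open>v\<close> turns the left side into an inner product of
  \<open>J_hor B v\<close> and \<open>J_hor B u\<close> at the same vector. Hence a curve in the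
  plane of a vector and its image under \<open>J_hor B u\<close> moves vertically along
  \<open>u\<close> only.\<close>

lemma B_J_hor: "B \<xi> (J_hor B u \<xi>) = (\<xi> \<bullet> \<xi>) *\<^sub>R u"
proof -
  have "v \<bullet> B \<xi> (J_hor B u \<xi>) = v \<bullet> ((\<xi> \<bullet> \<xi>) *\<^sub>R u)" for v
    using J_hor_inner_J_hor[of v \<xi> u] by (simp add: inner_J_hor)
  then show ?thesis using vector_eq_ldot by blast
qed

text \<open>A map that is both skew (by \<open>B_swap\<close>) and orthogonal squares to minus the
  identity.\<close>

lemma J_hor_J_hor:
  assumes "norm u = 1"
  shows "J_hor B u (J_hor B u \<xi>) = - \<xi>"
proof -
  have "J_hor B u (J_hor B u \<xi>) \<bullet> y = - \<xi> \<bullet> y" for y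
  proof -
    have "J_hor B u (J_hor B u \<xi>) \<bullet> y = - (u \<bullet> B y (J_hor B u \<xi>))"
      unfolding inner_J_hor B_swap[of "J_hor B u \<xi>" y] by simp
    also have "\<dots> = - (J_hor B u y \<bullet> J_hor B u \<xi>)"
      unfolding inner_J_hor ..
    finally show ?thesis by (simp add: J_hor_orthogonal[OF assms] inner_commute)
  qed
  then show ?thesis using vector_eq_rdot by blast
qed

lemma J_hor_lin_comb: "J_hor B u (a *\<^sub>R \<xi> + b *\<^sub>R \<eta>) = a *\<^sub>R J_hor B u \<xi> + b *\<^sub>R J_hor B u \<eta>"
proof -
  have "J_hor B u (a *\<^sub>R \<xi> + b *\<^sub>R \<eta>) \<bullet> y = (a *\<^sub>R J_hor B u \<xi> + b *\<^sub>R J_hor B u \<eta>) \<bullet> y" for y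
    by (simp add: inner_J_hor inner_add_left inner_add_right bilinear_ladd[OF bilinear_B]
        bilinear_lmul[OF bilinear_B])
  then show ?thesis using vector_eq_rdot by blast
qed

section \<open>Horizontal tangent vectors in coordinates\<close>

lemma X_field_combination:
  "(\<Sum>i\<in>UNIV. (a $ i) *\<^sub>R X_field B i q) = (a, (1/2) *\<^sub>R B (fst q) a)"
proof -
  have "(\<Sum>i\<in>UNIV. (a $ i) *\<^sub>R X_field B i q)
      = (\<Sum>i\<in>UNIV. ((a $ i) *\<^sub>R axis i 1, (1/2) *\<^sub>R B (fst q) ((a $ i) *\<^sub>R axis i 1)))"
    by (simp add: X_field_eq[OF H] linear_scale[OF linear_B])
  also have "\<dots> = ((\<Sum>i\<in>UNIV. (a $ i) *\<^sub>R axis i 1),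
      (1/2) *\<^sub>R B (fst q) (\<Sum>i\<in>UNIV. (a $ i) *\<^sub>R axis i 1))"
    by (simp add: sum_prod linear_sum[OF linear_B] scaleR_sum_right)
  also have "(\<Sum>i\<in>UNIV. (a $ i) *\<^sub>R axis i 1) = a"
    by (simp flip: scalar_mult_eq_scaleR add: basis_expansion)
  finally show ?thesis .
qed

text \<open>The coefficients of a combination of the fields form its first component, so
  horizontality is one linear equation for the second component. The later estimates use this
  equation in place of the span.\<close>

lemma horizontal_iff:
  "v \<in> span (range (\<lambda>i. X_field B i q)) \<longleftrightarrow> snd v = (1/2) *\<^sub>R B (fst q) (fst v)"
proof
  assume "v \<in> span (range (\<lambda>i. X_field B i q))"
  then show "snd v = (1/2) *\<^sub>R B (fst q) (fst v)"
  proof (induction rule: span_induct_alt)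
    case base
    show ?case by (simp add: linear_0[OF linear_B])
  next
    case (step c x y)
    then obtain i where "x = X_field B i q" by auto
    then show ?case using step.IH
      by (simp add: X_field_eq[OF H] linear_add[OF linear_B] linear_scale[OF linear_B] algebra_simps)
  qed
next
  assume "snd v = (1/2) *\<^sub>R B (fst q) (fst v)"
  then have "v = (\<Sum>i\<in>UNIV. (fst v $ i) *\<^sub>R X_field B i q)"
    by (simp add: X_field_combination prod_eq_iff)
  also have "\<dots> \<in> span (range (\<lambda>i. X_field B i q))"
    by (intro span_sum span_scale span_base) auto
  finally show "v \<in> span (range (\<lambda>i. X_field B i q))" .
qed

lemma hor_norm_eq:
  assumes "snd v = (1/2) *\<^sub>R B (fst q) (fst v)"
  shows "hor_norm B q v = norm (fst v)"
proof -
  have "(THE a. v = (\<Sum>i\<in>UNIV. (a $ i) *\<^sub>R X_field B i q)) = fst v"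
    using assms by (intro the_equality) (auto simp: X_field_combination prod_eq_iff)
  then show ?thesis by (simp add: hor_norm_def)
qed

end

section \<open>Upper bounds for the distance\<close>

lemma Lipschitz_imp_abs_continuous_on:
  assumes "\<And>u v. u \<in> I \<Longrightarrow> v \<in> I \<Longrightarrow> norm (f v - f u) \<le> M * \<bar>v - u\<bar>"
  shows "abs_continuous_on I f"
  unfolding abs_continuous_on_def
proof (intro allI impI)
  fix e :: real assume e: "e > 0"
  define d where "d = e / (\<bar>M\<bar> + 1)"
  have d: "d > 0" "\<bar>M\<bar> * d < e" using e by (auto simp: d_def field_simps)
  have "(\<Sum>K\<in>D. norm (f (Sup K) - f (Inf K))) < e"
    if D: "D division_of \<Union>D" "\<Union>D \<subseteq> I" "(\<Sum>K\<in>D. Sup K - Inf K) < d" for D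
  proof -
    have "(\<Sum>K\<in>D. norm (f (Sup K) - f (Inf K))) \<le> (\<Sum>K\<in>D. \<bar>M\<bar> * (Sup K - Inf K))"
    proof (rule sum_mono)
      fix K assume K: "K \<in> D"
      then obtain a b where ab: "K = {a..b}" "a \<le> b"
        using division_ofD(3,4)[OF D(1) K] by (metis atLeastatMost_empty_iff2 box_real(2))
      then have "K \<subseteq> I" using K D(2) by blast
      then have "a \<in> I" "b \<in> I" using ab by auto
      then show "norm (f (Sup K) - f (Inf K)) \<le> \<bar>M\<bar> * (Sup K - Inf K)"
        using assms[of a b] ab by (simp add: order_trans[OF _ mult_right_mono[OF abs_ge_self]])
    qed
    also have "\<dots> \<le> \<bar>M\<bar> * d"
      using D(3) by (simp flip: sum_distrib_left add: mult_left_mono)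
    finally show ?thesis using d by simp
  qed
  then show "\<exists>d>0. \<forall>D. D division_of \<Union>D \<and> \<Union>D \<subseteq> I \<and> (\<Sum>K\<in>D. Sup K - Inf K) < d \<longrightarrow>
      (\<Sum>K\<in>D. norm (f (Sup K) - f (Inf K))) < e"
    using d by blast
qed

lemma norm_increment_le:
  fixes f :: "real \<Rightarrow> 'a::banach"
  assumes "\<And>t. t \<in> {a..b} \<Longrightarrow> (f has_vector_derivative f' t) (at t)"
    and "\<And>t. t \<in> {a..b} \<Longrightarrow> norm (f' t) \<le> M" and "u \<in> {a..b}" "v \<in> {a..b}"
  shows "norm (f v - f u) \<le> M * \<bar>v - u\<bar>"
proof -
  have *: "norm (f v - f u) \<le> M * (v - u)" if "u \<le> v" "u \<in> {a..b}" "v \<in> {a..b}" for u v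
  proof -
    have "0 \<le> M" using assms(2)[OF that(2)] norm_ge_zero order_trans by blast
    moreover have "(f' has_integral (f v - f u)) {u..v}"
      using assms(1) that by (intro fundamental_theorem_of_calculus)
        (auto intro: has_vector_derivative_at_within)
    ultimately show ?thesis
      using has_integral_bound_real[of M "{}" f' "f v - f u" u v] assms(2) that by auto
  qed
  show ?thesis
    using *[of u v] *[of v u] assms(3,4) by (cases "u \<le> v") (auto simp: norm_minus_commute)
qed

text \<open>Bounded derivatives make the curve Lipschitz on \<open>{0..1}\<close>, hence absolutely
  continuous, and its length is the integral of the constant \<open>c\<close>.\<close>

lemma cc_dist_le_constant_speed:
  assumes H: "H_type_group B"
    and X: "\<And>t. (X has_vector_derivative X' t) (at t)"
    and Z: "\<And>t. (Z has_vector_derivative (1/2) *\<^sub>R B (X t) (X' t)) (at t)"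
    and speed: "\<And>t. norm (X' t) = c" and start: "X 0 = 0" "Z 0 = 0"
  shows "cc_dist B (X 1, Z 1) \<le> ereal c"
proof -
  define \<gamma> where "\<gamma> = (\<lambda>t. (X t, Z t))"
  have d: "(\<gamma> has_vector_derivative (X' t, (1/2) *\<^sub>R B (X t) (X' t))) (at t)" for t
    unfolding \<gamma>_def by (intro has_vector_derivative_Pair X Z)
  obtain K where K: "K > 0" "\<And>v w. norm (B v w) \<le> K * norm v * norm w"
    using bilinear_bounded_pos[OF bilinear_B[OF H]] by blast
  have c: "c \<ge> 0" using speed[of 0] by auto
  have Xb: "norm (X t) \<le> c" if "t \<in> {0..1}" for t
  proof -
    have "norm (X t - X 0) \<le> c * \<bar>t - 0\<bar>"
      using X speed that by (intro norm_increment_le[of 0 1]) auto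
    also have "\<dots> \<le> c" using that c by (auto intro: mult_left_le)
    finally show ?thesis using start by simp
  qed
  have "norm (X' t, (1/2) *\<^sub>R B (X t) (X' t)) \<le> c + K * c * c" if t: "t \<in> {0..1}" for t
  proof -
    have "norm (B (X t) (X' t)) \<le> K * c * c"
      using K(2)[of "X t" "X' t"] mult_right_mono[OF mult_left_mono[OF Xb[OF t], of K] c] K(1)
      unfolding speed by linarith
    moreover have "norm (X' t, (1/2) *\<^sub>R B (X t) (X' t)) \<le> c + norm (B (X t) (X' t)) / 2"
      using norm_Pair_le[of "X' t" "(1/2) *\<^sub>R B (X t) (X' t)"] by (simp add: speed)
    ultimately show ?thesis
      using norm_ge_zero[of "B (X t) (X' t)"] by linarith
  qed
  then have "abs_continuous_on {0..1} \<gamma>"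
    using norm_increment_le[of 0 1 \<gamma>, OF d]
    by (intro Lipschitz_imp_abs_continuous_on[where M = "c + K * c * c"]) blast
  moreover have "AE t in lebesgue_on {0..1}. \<exists>v\<in>span (range (\<lambda>i. X_field B i (\<gamma> t))).
      (\<gamma> has_vector_derivative v) (at t)"
    by (rule AE_I2) (use d in \<open>force simp: horizontal_iff[OF H] \<gamma>_def\<close>)
  ultimately have "horizontal_path B \<gamma>" by (simp add: horizontal_path_def)
  moreover have "hor_length B \<gamma> = c"
    unfolding hor_length_def vector_derivative_at[OF d]
    by (subst hor_norm_eq[OF H]) (simp_all add: \<gamma>_def speed)
  ultimately show ?thesis
    unfolding cc_dist_def using start
    by (intro INF_lower2[of \<gamma>]) (auto simp: \<gamma>_def)
qed

section \<open>Line segments and circular arcs as competitors\<close>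

lemma cc_dist_le_segment:
  assumes H: "H_type_group B"
  shows "cc_dist B (x, 0) \<le> ereal (norm x)"
proof -
  have "B (t *\<^sub>R x) x = 0" for t
    by (simp add: bilinear_lmul[OF bilinear_B[OF H]] B_self[OF H])
  then have "cc_dist B (1 *\<^sub>R x, 0) \<le> ereal (norm x)"
    by (intro cc_dist_le_constant_speed[OF H, where X = "\<lambda>t. t *\<^sub>R x" and X' = "\<lambda>_. x" and Z = "\<lambda>_. 0"])
       (auto intro!: derivative_eq_intros)
  then show ?thesis by simp
qed

text \<open>The projected curve is an arc of angle \<open>2 * \<theta>\<close> on a circle of
  diameter \<open>r\<close> through the origin, with initial direction \<open>p\<close>; its chord
  has length \<open>r * sin \<theta>\<close> if the sine is nonnegative. The coefficient of
  \<open>u\<close> is the signed area between arc and chord.\<close>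

lemma cc_dist_le_arc:
  assumes H: "H_type_group B" and p: "norm p = 1" and u: "norm u = 1" and "0 \<le> r" "0 \<le> \<theta>"
  shows "cc_dist B ((r * sin \<theta>) *\<^sub>R (cos \<theta> *\<^sub>R p + sin \<theta> *\<^sub>R J_hor B u p),
    (r\<^sup>2 / 8 * (2 * \<theta> - sin (2 * \<theta>))) *\<^sub>R u) \<le> ereal (r * \<theta>)"
proof -
  define J where "J = J_hor B u p"
  define X where "X = (\<lambda>t. (r / 2 * sin (2 * \<theta> * t)) *\<^sub>R p + (r / 2 * (1 - cos (2 * \<theta> * t))) *\<^sub>R J)"
  define X' where "X' = (\<lambda>t. (r * \<theta> * cos (2 * \<theta> * t)) *\<^sub>R p + (r * \<theta> * sin (2 * \<theta> * t)) *\<^sub>R J)"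
  define Z where "Z = (\<lambda>t. (r\<^sup>2 / 8 * (2 * \<theta> * t - sin (2 * \<theta> * t))) *\<^sub>R u)"
  have pp: "p \<bullet> p = 1" using p by (simp add: dot_square_norm)
  have pJ: "p \<bullet> J = 0" using J_hor_self[OF H, of u p] by (simp add: J_def inner_commute)
  have Jp: "J \<bullet> p = 0" using pJ by (simp add: inner_commute)
  have JJ: "J \<bullet> J = 1" using J_hor_orthogonal[OF H u, of p p] pp by (simp add: J_def)
  have BpJ: "B p J = u" using B_J_hor[OF H, of p u] pp by (simp add: J_def)
  have BJp: "B J p = - u" using B_swap[OF H, of J p] BpJ by simp
  note bil = bilinear_ladd[OF bilinear_B[OF H]] bilinear_radd[OF bilinear_B[OF H]]
    bilinear_lmul[OF bilinear_B[OF H]] bilinear_rmul[OF bilinear_B[OF H]]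
  have "cc_dist B (X 1, Z 1) \<le> ereal (r * \<theta>)"
  proof (rule cc_dist_le_constant_speed[OF H])
    show "(X has_vector_derivative X' t) (at t)" for t
      unfolding X_def X'_def by (auto intro!: derivative_eq_intros simp: algebra_simps)
    \<comment> \<open>Here \<open>s\<close> and \<open>c\<close> stand for the sine and cosine of
      the running angle; \<open>s\<^sup>2 + c\<^sup>2\<close> becomes 1 on substitution.\<close>
    have "B ((r / 2 * s) *\<^sub>R p + (r / 2 * (1 - c)) *\<^sub>R J) ((r * \<theta> * c) *\<^sub>R p + (r * \<theta> * s) *\<^sub>R J)
        = (r\<^sup>2 * \<theta> / 2 * (s\<^sup>2 + c\<^sup>2 - c)) *\<^sub>R u" for s c
      by (simp add: bil B_self[OF H] BpJ BJp scaleR_left_diff_distrib[symmetric]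
          scaleR_left_distrib[symmetric] power2_eq_square) (simp add: algebra_simps)
    then have "B (X t) (X' t) = (r\<^sup>2 * \<theta> / 2 * (1 - cos (2 * \<theta> * t))) *\<^sub>R u" for t
      unfolding X_def X'_def by simp
    then have "(1/2) *\<^sub>R B (X t) (X' t) = (r\<^sup>2 * \<theta> / 4 * (1 - cos (2 * \<theta> * t))) *\<^sub>R u" for t
      by simp
    moreover have "((\<lambda>t. r\<^sup>2 / 8 * (2 * \<theta> * t - sin (2 * \<theta> * t)))
        has_real_derivative r\<^sup>2 * \<theta> / 4 * (1 - cos (2 * \<theta> * t))) (at t)" for t
      by (auto intro!: derivative_eq_intros simp: field_simps)
    ultimately show "(Z has_vector_derivative (1/2) *\<^sub>R B (X t) (X' t)) (at t)" for t
      using has_vector_derivative_scaleR[OF _ has_vector_derivative_const[of u "at t"]]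
      unfolding Z_def by fastforce
    have "(norm ((r * \<theta> * c) *\<^sub>R p + (r * \<theta> * s) *\<^sub>R J))\<^sup>2 = (r * \<theta>)\<^sup>2 * (s\<^sup>2 + c\<^sup>2)" for s c
      unfolding power2_norm_eq_inner
      by (simp add: inner_add_left inner_add_right pp pJ JJ Jp power2_eq_square algebra_simps)
    then have "(norm (X' t))\<^sup>2 = (r * \<theta>)\<^sup>2" for t
      unfolding X'_def by (simp only: sin_cos_squared_add mult_1_right)
    then show "norm (X' t) = r * \<theta>" for t
      using assms(4,5) by (metis mult_nonneg_nonneg norm_ge_zero power2_eq_imp_eq)
  qed (auto simp: X_def Z_def)
  \<comment> \<open>Double-angle formulas express that the chord makes half the arc's angle,
    \<open>\<theta>\<close>, with the initial direction.\<close>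
  moreover have "X 1 = (r * sin \<theta>) *\<^sub>R (cos \<theta> *\<^sub>R p + sin \<theta> *\<^sub>R J)"
  proof -
    have "r / 2 * sin (2 * \<theta>) = r * sin \<theta> * cos \<theta>" "r / 2 * (1 - cos (2 * \<theta>)) = r * sin \<theta> * sin \<theta>"
      by (simp_all only: sin_double cos_double_sin power2_eq_square) auto
    moreover have "X 1 = (r / 2 * sin (2 * \<theta>)) *\<^sub>R p + (r / 2 * (1 - cos (2 * \<theta>))) *\<^sub>R J"
      by (simp add: X_def)
    ultimately show ?thesis by (simp only: scaleR_add_right scaleR_scaleR)
  qed
  ultimately show ?thesis by (simp add: Z_def J_def)
qed

section \<open>Lower bounds for the length\<close>

text \<open>Stands in for the argument that a nonpositive derivative of \<open>G\<close> with
  respect to \<open>\<tau>\<close> makes \<open>G\<close> decrease. Over \<open>n\<close> steps the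
  quadratic errors total \<open>C * L\<^sup>2 / n\<close>, which tends to 0.\<close>

lemma decrease_of_quadratic_increment:
  fixes \<tau> G :: "real \<Rightarrow> real"
  assumes cont: "continuous_on {0..1} \<tau>" and t0: "\<tau> 0 = 0"
    and mono: "\<And>a b. 0 \<le> a \<Longrightarrow> a \<le> b \<Longrightarrow> b \<le> 1 \<Longrightarrow> \<tau> a \<le> \<tau> b"
    and G: "\<And>a b. 0 \<le> a \<Longrightarrow> a \<le> b \<Longrightarrow> b \<le> 1 \<Longrightarrow> G b \<le> G a + C * (\<tau> b - \<tau> a)\<^sup>2"
  shows "G 1 \<le> G 0"
proof -
  define L where "L = \<tau> 1"
  have L: "L \<ge> 0" using mono[of 0 1] t0 by (simp add: L_def)
  have *: "G 1 \<le> G 0 + C * L\<^sup>2 / real n" if n: "n > 0" for n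
  proof -
    \<comment> \<open>a partition into \<open>n\<close> steps equal in \<open>\<tau>\<close>, not in the parameter: the errors add up to \<open>O(1/n)\<close>\<close>
    have "\<exists>t\<in>{0..1}. \<tau> t = real i * (L / n) \<and> G t \<le> G 0 + real i * (C * (L / n)\<^sup>2)" if "i \<le> n" for i
      using that
    proof (induction i)
      case 0
      show ?case using t0 by (intro bexI[of _ 0]) auto
    next
      case (Suc i)
      then obtain t where t: "t \<in> {0..1}" "\<tau> t = real i * (L / n)"
        "G t \<le> G 0 + real i * (C * (L / n)\<^sup>2)" by auto
      have "real (Suc i) * (L / n) \<le> real n * (L / n)"
        using Suc.prems L by (intro mult_right_mono) auto
      then have "real (Suc i) * (L / n) \<le> \<tau> 1" using n by (simp add: L_def)
      moreover have "\<tau> t \<le> real (Suc i) * (L / n)"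
        unfolding t(2) using L by (intro mult_right_mono) auto
      moreover have "continuous_on {t..1} \<tau>"
        using t(1) by (intro continuous_on_subset[OF cont]) auto
      ultimately obtain s where s: "t \<le> s" "s \<le> 1" "\<tau> s = real (Suc i) * (L / n)"
        using IVT'[of \<tau> t _ 1] t(1) by auto
      have d: "\<tau> s - \<tau> t = L / n" using s t by (simp add: algebra_simps add_divide_distrib)
      have "G s \<le> G t + C * (L / n)\<^sup>2"
        using G[of t s] s t(1) unfolding d by auto
      also have "\<dots> \<le> G 0 + real (Suc i) * (C * (L / n)\<^sup>2)"
        using t(3) by (simp add: algebra_simps)
      finally show ?case using s t by (intro bexI[of _ s]) auto
    qed
    from this[of n] obtain t where t: "t \<in> {0..1}" "\<tau> t = L" "G t \<le> G 0 + real n * (C * (L / n)\<^sup>2)"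
      using n by auto
    \<comment> \<open>The last node \<open>t\<close> may differ from 1 if \<open>\<tau>\<close> is
      constant near the end, but then the quadratic error on \<open>{t..1}\<close> is 0.\<close>
    have "G 1 \<le> G t" using G[of t 1] t by (simp add: L_def)
    then show ?thesis using t(3) n by (simp add: power2_eq_square)
  qed
  have "(\<lambda>n. G 0 + C * L\<^sup>2 / real n) \<longlonglongrightarrow> G 0 + 0"
    by (intro tendsto_intros tendsto_divide_0[OF tendsto_const] filterlim_real_sequentially[THEN filterlim_at_top_imp_at_infinity])
  then show ?thesis
    using * by (intro tendsto_lowerbound[of _ "G 0" sequentially "G 1"])
      (auto simp: eventually_sequentially intro!: exI[of _ 1])
qed

text \<open>The equation bounds the derivative of a bounded solution and makes it Lipschitz, so the
  first-order Taylor remainder is quadratic. It is bounded from above only, as it will be multiplied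
  by a squared norm.\<close>

lemma riccati_quadratic_remainder:
  fixes \<phi> :: "real \<Rightarrow> real"
  assumes "K > 0" "L \<ge> 0"
    and d: "\<And>s. s \<in> {0..L} \<Longrightarrow> (\<phi> has_real_derivative - (\<theta>\<^sup>2 + (\<phi> s)\<^sup>2) / K) (at s)"
  obtains M D C where "\<And>s. s \<in> {0..L} \<Longrightarrow> \<bar>\<phi> s\<bar> \<le> M"
    and "\<And>s s'. 0 \<le> s \<Longrightarrow> s \<le> s' \<Longrightarrow> s' \<le> L \<Longrightarrow> \<bar>\<phi> s' - \<phi> s\<bar> \<le> D * (s' - s)"
    and "\<And>s s'. 0 \<le> s \<Longrightarrow> s \<le> s' \<Longrightarrow> s' \<le> L \<Longrightarrow>
      \<phi> s' - \<phi> s + (\<theta>\<^sup>2 + (\<phi> s)\<^sup>2) / K * (s' - s) \<le> C * (s' - s)\<^sup>2"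
    and "M \<ge> 0" "D \<ge> 0" "C \<ge> 0"
proof -
  have "continuous_on {0..L} \<phi>"
    using d by (intro continuous_at_imp_continuous_on ballI DERIV_isCont)
  then have "bounded (\<phi> ` {0..L})"
    by (intro compact_imp_bounded compact_continuous_image) auto
  then obtain M where M: "M > 0" "\<And>s. s \<in> {0..L} \<Longrightarrow> \<bar>\<phi> s\<bar> \<le> M"
    by (auto simp: bounded_pos)
  define D where "D = (\<theta>\<^sup>2 + M\<^sup>2) / K"
  have D0: "D \<ge> 0" using assms by (simp add: D_def)
  have sq: "(\<phi> s)\<^sup>2 \<le> M\<^sup>2" if "s \<in> {0..L}" for s
    using M(2)[OF that] by (rule abs_le_square_iff[THEN iffD1, OF order_trans[OF _ abs_ge_self]])
  have mvt: "\<exists>r. s < r \<and> r < s' \<and> \<phi> s' - \<phi> s = (s' - s) * (- (\<theta>\<^sup>2 + (\<phi> r)\<^sup>2) / K)"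
    if "0 \<le> s" "s < s'" "s' \<le> L" for s s'
    using MVT2[of s s' \<phi> "\<lambda>r. - (\<theta>\<^sup>2 + (\<phi> r)\<^sup>2) / K"] d that by auto
  have D: "\<bar>\<phi> s' - \<phi> s\<bar> \<le> D * (s' - s)" if s: "0 \<le> s" "s \<le> s'" "s' \<le> L" for s s'
  proof (cases "s = s'")
    case False
    then obtain r where r: "s < r" "r < s'" "\<phi> s' - \<phi> s = (s' - s) * (- (\<theta>\<^sup>2 + (\<phi> r)\<^sup>2) / K)"
      using mvt[of s s'] s by auto
    have "(\<theta>\<^sup>2 + (\<phi> r)\<^sup>2) / K \<le> D"
      unfolding D_def using sq[of r] r s assms(1) by (intro divide_right_mono) auto
    moreover have "\<bar>\<phi> s' - \<phi> s\<bar> = (s' - s) * ((\<theta>\<^sup>2 + (\<phi> r)\<^sup>2) / K)"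
      using s assms(1) unfolding r(3) by (simp add: abs_mult)
    ultimately show ?thesis
      using mult_left_mono[of "(\<theta>\<^sup>2 + (\<phi> r)\<^sup>2) / K" D "s' - s"] s by (simp only: mult.commute)
  qed simp
  have C: "\<phi> s' - \<phi> s + (\<theta>\<^sup>2 + (\<phi> s)\<^sup>2) / K * (s' - s) \<le> (2 * M * D / K) * (s' - s)\<^sup>2"
    if s: "0 \<le> s" "s \<le> s'" "s' \<le> L" for s s'
  proof (cases "s = s'")
    case False
    then obtain r where r: "s < r" "r < s'" "\<phi> s' - \<phi> s = (s' - s) * (- (\<theta>\<^sup>2 + (\<phi> r)\<^sup>2) / K)"
      using mvt[of s s'] s by auto
    \<comment> \<open>The mean value theorem evaluates the derivative at \<open>r\<close> instead of
      \<open>s\<close>; the difference of squares measures that error.\<close>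
    have "(\<phi> s)\<^sup>2 - (\<phi> r)\<^sup>2 = (\<phi> s + \<phi> r) * (\<phi> s - \<phi> r)"
      by (simp add: power2_eq_square algebra_simps)
    also have "\<dots> \<le> \<bar>\<phi> s + \<phi> r\<bar> * \<bar>\<phi> r - \<phi> s\<bar>"
      by (metis abs_ge_self abs_minus_commute abs_mult)
    also have "\<dots> \<le> (2 * M) * (D * (s' - s))"
    proof (rule mult_mono)
      show "\<bar>\<phi> s + \<phi> r\<bar> \<le> 2 * M" using M(2)[of s] M(2)[of r] r s by auto
      have "\<bar>\<phi> r - \<phi> s\<bar> \<le> D * (r - s)" using D[of s r] r s by auto
      also have "\<dots> \<le> D * (s' - s)" using D0 r by (intro mult_left_mono) auto
      finally show "\<bar>\<phi> r - \<phi> s\<bar> \<le> D * (s' - s)" .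
    qed (use M in auto)
    finally have "((\<phi> s)\<^sup>2 - (\<phi> r)\<^sup>2) * ((s' - s) / K) \<le> ((2 * M) * (D * (s' - s))) * ((s' - s) / K)"
      using s assms(1) by (intro mult_right_mono) auto
    moreover have "\<phi> s' - \<phi> s + (\<theta>\<^sup>2 + (\<phi> s)\<^sup>2) / K * (s' - s) = ((\<phi> s)\<^sup>2 - (\<phi> r)\<^sup>2) * ((s' - s) / K)"
      unfolding r(3) using assms(1) by (simp add: field_simps)
    moreover have "((2 * M) * (D * (s' - s))) * ((s' - s) / K) = (2 * M * D / K) * (s' - s)\<^sup>2"
      by (simp add: power2_eq_square)
    ultimately show ?thesis by linarith
  qed simp
  show thesis
    using that[of M D "2 * M * D / K"] M D C D0 assms(1) by auto
qed

text \<open>\<open>\<tau>\<close> is arc length. Freezing the base point at \<open>a\<close> in the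
  horizontality equation costs half the integral of \<open>B (x(t) - x(a)) (x'(t))\<close>, and both
  arguments are controlled by \<open>\<tau>\<close>, whence the square.\<close>

lemma horizontal_path_increments:
  assumes H: "H_type_group B" and path: "horizontal_path B \<gamma>"
  obtains \<tau> K where "continuous_on {0..1} \<tau>" "\<tau> 0 = 0" "\<tau> 1 = hor_length B \<gamma>"
    and "\<And>a b. 0 \<le> a \<Longrightarrow> a \<le> b \<Longrightarrow> b \<le> 1 \<Longrightarrow> norm (fst (\<gamma> b) - fst (\<gamma> a)) \<le> \<tau> b - \<tau> a"
    and "K \<ge> 0"
    and "\<And>a b. 0 \<le> a \<Longrightarrow> a \<le> b \<Longrightarrow> b \<le> 1 \<Longrightarrow>
      norm (snd (\<gamma> b) - snd (\<gamma> a) - (1/2) *\<^sub>R B (fst (\<gamma> a)) (fst (\<gamma> b) - fst (\<gamma> a)))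
        \<le> K * (\<tau> b - \<tau> a)\<^sup>2"
proof -
  define v where "v = (\<lambda>t. vector_derivative \<gamma> (at t))"
  then have v_deriv: "vector_derivative \<gamma> (at t) = v t" for t by simp
  define N where "N = {t\<in>{0..1}. \<not> (\<exists>v \<in> span (range (\<lambda>i. X_field B i (\<gamma> t))). (\<gamma> has_vector_derivative v) (at t))}"
  have ac: "abs_continuous_on {0..1} \<gamma>" using path by (simp add: horizontal_path_def)
  have N: "negligible N"
  proof -
    have "AE t in lebesgue_on {0..1}.
        \<exists>v \<in> span (range (\<lambda>i. X_field B i (\<gamma> t))). (\<gamma> has_vector_derivative v) (at t)"
      using path by (simp add: horizontal_path_def)
    then obtain N' where "N \<subseteq> N'" "N' \<in> null_sets (lebesgue_on {0..1})"
      unfolding eventually_ae_filter N_def by auto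
    then show ?thesis
      by (metis negligible_iff_null_sets negligible_subset null_sets_restrict_space sets.top
          lmeasurable_interval(1) fmeasurableD Int_iff box_real(2) lmeasurable_cbox)
  qed
  have der: "(\<gamma> has_vector_derivative v t) (at t)"
    and hor: "snd (v t) = (1/2) *\<^sub>R B (fst (\<gamma> t)) (fst (v t))" if "t \<in> {0..1} - N" for t
    using that horizontal_iff[OF H, of _ "\<gamma> t"] by (auto simp: N_def v_def vector_derivative_at)
  have vint: "(v has_integral (\<gamma> b - \<gamma> a)) {a..b}" if "0 \<le> a" "a \<le> b" "b \<le> 1" for a b
    using that by (intro abs_continuous_has_integral[OF _ abs_continuous_on_subset[OF ac] N])
      (auto intro!: has_vector_derivative_at_within der)
  have "v absolutely_integrable_on {0..1}"
    by (rule abs_continuous_absolutely_integrable[OF ac N]) (auto intro!: has_vector_derivative_at_within der)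
  then have "(\<lambda>t. fst (v t)) absolutely_integrable_on {0..1}"
    using absolutely_integrable_linear[OF _ bounded_linear_fst] by (force simp: o_def)
  define g where "g = (\<lambda>t. norm (fst (v t)))"
  have g: "g integrable_on {0..1}"
    using \<open>(\<lambda>t. fst (v t)) absolutely_integrable_on {0..1}\<close>
    unfolding g_def absolutely_integrable_on_def by blast
  define \<tau> where "\<tau> = (\<lambda>t. integral {0..t} g)"
  have gab: "g integrable_on {a..b}" if "0 \<le> a" "b \<le> 1" for a b
    using integrable_on_subinterval[OF g] that by auto
  have \<tau>diff: "\<tau> b - \<tau> a = integral {a..b} g" if "0 \<le> a" "a \<le> b" "b \<le> 1" for a b
    using Henstock_Kurzweil_Integration.integral_combine[of 0 a b g] gab that by (simp add: \<tau>_def)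
  obtain K where K: "K > 0" "\<And>v w. norm (B v w) \<le> K * norm v * norm w"
    using bilinear_bounded_pos[OF bilinear_B[OF H]] by blast
  have xint: "((\<lambda>t. fst (v t)) has_integral (fst (\<gamma> b) - fst (\<gamma> a))) {a..b}"
    and zint: "((\<lambda>t. snd (v t)) has_integral (snd (\<gamma> b) - snd (\<gamma> a))) {a..b}"
    if "0 \<le> a" "a \<le> b" "b \<le> 1" for a b
    using has_integral_linear[OF vint[OF that] bounded_linear_fst]
      has_integral_linear[OF vint[OF that] bounded_linear_snd] by (simp_all add: o_def)
  have dx: "norm (fst (\<gamma> b) - fst (\<gamma> a)) \<le> \<tau> b - \<tau> a" if ab: "0 \<le> a" "a \<le> b" "b \<le> 1" for a b
  proof -
    have "norm (integral {a..b} (\<lambda>t. fst (v t))) \<le> integral {a..b} g"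
      using xint[OF ab] gab[OF ab(1,3)]
      by (intro Henstock_Kurzweil_Integration.integral_norm_bound_integral) (auto simp: g_def)
    then show ?thesis using integral_unique[OF xint[OF ab]] \<tau>diff[OF ab] by simp
  qed
  show thesis
  proof (rule that[of \<tau> "K / 2"])
    show "continuous_on {0..1} \<tau>"
      unfolding \<tau>_def using g by (rule indefinite_integral_continuous_1)
    show "\<tau> 0 = 0" by (simp add: \<tau>_def)
    show "\<tau> 1 = hor_length B \<gamma>"
      unfolding \<tau>_def hor_length_def using N
      by (rule integral_spike) (auto simp: v_deriv g_def hor_norm_eq[OF H] hor)
    show "K / 2 \<ge> 0" using K by simp
    fix a b :: real assume ab: "0 \<le> a" "a \<le> b" "b \<le> 1"
    show "norm (fst (\<gamma> b) - fst (\<gamma> a)) \<le> \<tau> b - \<tau> a" by (rule dx[OF ab])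
    let ?I = "snd (\<gamma> b) - snd (\<gamma> a) - (1/2) *\<^sub>R B (fst (\<gamma> a)) (fst (\<gamma> b) - fst (\<gamma> a))"
    \<comment> \<open>Set to 0 on \<open>N\<close>, because the norm bound for the integral is
      applied at every point of \<open>{a..b}\<close>.\<close>
    define F where "F = (\<lambda>t. if t \<in> N then 0 else snd (v t) - (1/2) *\<^sub>R B (fst (\<gamma> a)) (fst (v t)))"
    have "bounded_linear (B (fst (\<gamma> a)))"
      using linear_B[OF H] linear_conv_bounded_linear by blast
    then have "((\<lambda>t. snd (v t) - (1/2) *\<^sub>R B (fst (\<gamma> a)) (fst (v t))) has_integral ?I) {a..b}"
      using has_integral_linear[OF xint[OF ab]]
      by (intro has_integral_diff zint[OF ab] has_integral_cmul) (auto simp: o_def)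
    then have FI: "(F has_integral ?I) {a..b}"
      using N by (rule has_integral_spike[rotated 2]) (auto simp: F_def)
    have "norm (F t) \<le> K / 2 * (\<tau> b - \<tau> a) * g t" if t: "t \<in> {a..b}" for t
    proof (cases "t \<in> N")
      case True
      then show ?thesis using K dx[OF ab] order_trans[OF norm_ge_zero] by (force simp: F_def g_def)
    next
      case False
      have "F t = (1/2) *\<^sub>R B (fst (\<gamma> t) - fst (\<gamma> a)) (fst (v t))"
        using False hor[of t] t ab by (simp add: F_def bilinear_lsub[OF bilinear_B[OF H]] scaleR_diff_right)
      then have "norm (F t) \<le> K * norm (fst (\<gamma> t) - fst (\<gamma> a)) * g t / 2"
        using K(2)[of "fst (\<gamma> t) - fst (\<gamma> a)" "fst (v t)"] by (simp add: g_def)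
      also have "norm (fst (\<gamma> t) - fst (\<gamma> a)) \<le> \<tau> b - \<tau> a"
        using dx[of a t] dx[of t b] norm_ge_zero[of "fst (\<gamma> b) - fst (\<gamma> t)"] t ab
        unfolding atLeastAtMost_iff by linarith
      finally show ?thesis using K by (simp add: g_def mult_left_mono mult_right_mono)
    qed
    then have "norm (integral {a..b} F) \<le> integral {a..b} (\<lambda>t. K / 2 * (\<tau> b - \<tau> a) * g t)"
      using FI gab[OF ab(1,3)]
      by (intro Henstock_Kurzweil_Integration.integral_norm_bound_integral)
        (auto intro!: integrable_on_mult_right)
    also have "\<dots> = K / 2 * (\<tau> b - \<tau> a)\<^sup>2"
      by (simp add: \<tau>diff[OF ab] power2_eq_square)
    finally show "norm ?I \<le> K / 2 * (\<tau> b - \<tau> a)\<^sup>2"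
      using integral_unique[OF FI] by simp
  qed
qed

text \<open>One step of the path: \<open>\<xi>\<close> is the position, \<open>\<eta>\<close> and
  \<open>\<zeta>\<close> are the increments, \<open>h\<close> is the arc length, \<open>q\<close>
  and \<open>q'\<close> are the values of the Riccati solution at the ends. The first-order terms in
  the path increments combine to \<open>2 * (w \<bullet> \<eta>)\<close>; completing the square
  bounds this by \<open>K' * h\<close> plus a term that the Riccati inequality cancels. All else is
  quadratic in \<open>h\<close>.\<close>

lemma calibration_increment:
  assumes H: "H_type_group B" and u: "norm u = 1" and \<xi>: "norm \<xi> \<le> L" and \<eta>: "norm \<eta> \<le> h"
    and \<zeta>: "norm (\<zeta> - (1/2) *\<^sub>R B \<xi> \<eta>) \<le> K * h\<^sup>2" and \<theta>: "\<theta> \<ge> 0" and K': "K' > 0"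
    and M: "\<bar>q'\<bar> \<le> M" and D: "\<bar>q' - q\<bar> \<le> D * h"
    and C: "q' - q + (\<theta>\<^sup>2 + q\<^sup>2) / K' * h \<le> C * h\<^sup>2" and nonneg: "C \<ge> 0"
  shows "(norm (\<xi> + \<eta>))\<^sup>2 * q' - (norm \<xi>)\<^sup>2 * q + 4 * \<theta> * (u \<bullet> \<zeta>)
    \<le> K' * h + (L\<^sup>2 * C + 2 * L * D + M + 4 * \<theta> * K) * h\<^sup>2"
proof -
  have h: "h \<ge> 0" using \<eta> norm_ge_zero order_trans by blast
  have L: "L \<ge> 0" using \<xi> norm_ge_zero order_trans by blast
  define w where "w = q *\<^sub>R \<xi> + \<theta> *\<^sub>R J_hor B u \<xi>"
  have JJ: "J_hor B u \<xi> \<bullet> J_hor B u \<xi> = (norm \<xi>)\<^sup>2"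
    using J_hor_orthogonal[OF H u, of \<xi> \<xi>] by (simp add: power2_norm_eq_inner)
  have J0: "J_hor B u \<xi> \<bullet> \<xi> = 0" "\<xi> \<bullet> J_hor B u \<xi> = 0"
    using J_hor_self[OF H, of u \<xi>] by (auto simp: inner_commute)
  have "w \<bullet> w = (\<theta>\<^sup>2 + q\<^sup>2) * (norm \<xi>)\<^sup>2"
    by (simp add: w_def inner_add_left inner_add_right JJ J0 dot_square_norm[of \<xi>]
        power2_eq_square algebra_simps)
  then have ww: "(norm w)\<^sup>2 = (\<theta>\<^sup>2 + q\<^sup>2) * (norm \<xi>)\<^sup>2" by (simp add: power2_norm_eq_inner)
  have "w \<bullet> \<eta> \<le> norm w * h"
    using norm_cauchy_schwarz[of w \<eta>] mult_left_mono[OF \<eta> norm_ge_zero[of w]] by linarith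
  \<comment> \<open>Completion of the square with weight \<open>K'\<close>.\<close>
  moreover have "2 * norm w \<le> K' + (norm w)\<^sup>2 / K'"
  proof -
    have "0 \<le> (K' - norm w)\<^sup>2 / K'" using K' by simp
    also have "\<dots> = K' + (norm w)\<^sup>2 / K' - 2 * norm w"
      using K' by (simp add: field_simps power2_eq_square)
    finally show ?thesis by simp
  qed
  then have "2 * norm w * h \<le> (K' + (norm w)\<^sup>2 / K') * h"
    using h by (rule mult_right_mono)
  ultimately have 1: "2 * (w \<bullet> \<eta>) \<le> K' * h + (norm \<xi>)\<^sup>2 * ((\<theta>\<^sup>2 + q\<^sup>2) / K' * h)"
    unfolding ww by (simp add: algebra_simps)
  have "(norm \<xi>)\<^sup>2 * (q' - q + (\<theta>\<^sup>2 + q\<^sup>2) / K' * h) \<le> (norm \<xi>)\<^sup>2 * (C * h\<^sup>2)"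
    using C by (intro mult_left_mono) auto
  also have "\<dots> \<le> L\<^sup>2 * (C * h\<^sup>2)"
    using \<xi> nonneg by (intro mult_right_mono power_mono) auto
  finally have 2: "(norm \<xi>)\<^sup>2 * (q' - q) + (norm \<xi>)\<^sup>2 * ((\<theta>\<^sup>2 + q\<^sup>2) / K' * h) \<le> L\<^sup>2 * C * h\<^sup>2"
    by (simp add: algebra_simps)
  have "(\<xi> \<bullet> \<eta>) * (q' - q) \<le> \<bar>\<xi> \<bullet> \<eta>\<bar> * \<bar>q' - q\<bar>"
    by (metis abs_ge_self abs_mult)
  also have "\<dots> \<le> (L * h) * (D * h)"
  proof (rule mult_mono)
    have "\<bar>\<xi> \<bullet> \<eta>\<bar> \<le> norm \<xi> * norm \<eta>" by (rule Cauchy_Schwarz_ineq2)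
    also have "\<dots> \<le> L * h" using \<xi> \<eta> L by (intro mult_mono) auto
    finally show "\<bar>\<xi> \<bullet> \<eta>\<bar> \<le> L * h" .
  qed (use D L h in auto)
  finally have 3: "(\<xi> \<bullet> \<eta>) * (q' - q) \<le> L * D * h\<^sup>2" by (simp add: power2_eq_square algebra_simps)
  have "(norm \<eta>)\<^sup>2 * q' \<le> (norm \<eta>)\<^sup>2 * M"
    using M by (intro mult_left_mono) auto
  also have "\<dots> \<le> h\<^sup>2 * M"
    using \<eta> M by (intro mult_right_mono power_mono) auto
  finally have 4: "(norm \<eta>)\<^sup>2 * q' \<le> M * h\<^sup>2" by (simp add: mult.commute)
  \<comment> \<open>Pairing with \<open>u\<close> converts the bracket into
    \<open>J_hor B u \<xi>\<close>, which is how the vertical increment enters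
    \<open>w\<close>.\<close>
  have "u \<bullet> (\<zeta> - (1/2) *\<^sub>R B \<xi> \<eta>) \<le> K * h\<^sup>2"
    using norm_cauchy_schwarz[of u "\<zeta> - (1/2) *\<^sub>R B \<xi> \<eta>"] \<zeta> u by simp
  then have "u \<bullet> \<zeta> \<le> (1/2) * (J_hor B u \<xi> \<bullet> \<eta>) + K * h\<^sup>2"
    by (simp add: inner_diff_right inner_J_hor[OF H])
  then have "4 * \<theta> * (u \<bullet> \<zeta>) \<le> 4 * \<theta> * ((1/2) * (J_hor B u \<xi> \<bullet> \<eta>) + K * h\<^sup>2)"
    using \<theta> by (intro mult_left_mono) auto
  then have 5: "4 * \<theta> * (u \<bullet> \<zeta>) \<le> 2 * (w \<bullet> \<eta>) - 2 * q * (\<xi> \<bullet> \<eta>) + 4 * \<theta> * K * h\<^sup>2"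
    by (simp add: w_def inner_add_left algebra_simps)
  have "(norm (\<xi> + \<eta>))\<^sup>2 = (norm \<xi>)\<^sup>2 + 2 * (\<xi> \<bullet> \<eta>) + (norm \<eta>)\<^sup>2"
    by (simp add: power2_norm_eq_inner inner_add_left inner_add_right inner_commute)
  then have "(norm (\<xi> + \<eta>))\<^sup>2 * q' - (norm \<xi>)\<^sup>2 * q
      = (norm \<xi>)\<^sup>2 * (q' - q) + 2 * ((\<xi> \<bullet> \<eta>) * (q' - q)) + 2 * q * (\<xi> \<bullet> \<eta>) + (norm \<eta>)\<^sup>2 * q'"
    by (simp add: algebra_simps)
  then show ?thesis using 1 2 3 4 5 by (simp add: algebra_simps)
qed

lemma hor_length_bounds:
  assumes H: "H_type_group B" and path: "horizontal_path B \<gamma>" and start: "\<gamma> 0 = (0, 0)"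
    and end1: "\<gamma> 1 = (x, z)"
  shows "norm x \<le> hor_length B \<gamma>"
    and "0 < \<theta> \<Longrightarrow> \<theta> < pi \<Longrightarrow> (norm x)\<^sup>2 * (\<theta> * cot \<theta>) + 4 * \<theta> * norm z \<le> (hor_length B \<gamma>)\<^sup>2"
proof -
  define L where "L = hor_length B \<gamma>"
  obtain \<tau> K where \<tau>: "continuous_on {0..1} \<tau>" "\<tau> 0 = 0" "\<tau> 1 = L"
    and dx: "\<And>a b. 0 \<le> a \<Longrightarrow> a \<le> b \<Longrightarrow> b \<le> 1 \<Longrightarrow> norm (fst (\<gamma> b) - fst (\<gamma> a)) \<le> \<tau> b - \<tau> a"
    and K: "K \<ge> 0"
    and dz: "\<And>a b. 0 \<le> a \<Longrightarrow> a \<le> b \<Longrightarrow> b \<le> 1 \<Longrightarrow>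
      norm (snd (\<gamma> b) - snd (\<gamma> a) - (1/2) *\<^sub>R B (fst (\<gamma> a)) (fst (\<gamma> b) - fst (\<gamma> a)))
        \<le> K * (\<tau> b - \<tau> a)\<^sup>2"
    using horizontal_path_increments[OF H path] unfolding L_def by metis
  show xL: "norm x \<le> hor_length B \<gamma>"
    using dx[of 0 1] \<tau> start end1 by (simp add: L_def)
  then have L: "L \<ge> 0" using norm_ge_zero order_trans unfolding L_def by blast
  have mono: "\<tau> a \<le> \<tau> b" if "0 \<le> a" "a \<le> b" "b \<le> 1" for a b
    using dx[OF that] norm_ge_zero[of "fst (\<gamma> b) - fst (\<gamma> a)"] by linarith
  have \<tau>L: "\<tau> a \<in> {0..L}" if "0 \<le> a" "a \<le> 1" for a
    using mono[of 0 a] mono[of a 1] that \<tau> by simp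
  have xa: "norm (fst (\<gamma> a)) \<le> L" if "0 \<le> a" "a \<le> 1" for a
    using dx[of 0 a] \<tau>L[OF that] that \<tau>(2) start by simp
  assume \<theta>: "0 < \<theta>" "\<theta> < pi"
  obtain e :: "real^'b" where e: "norm e = 1" using vector_choose_size[of 1] by auto
  \<comment> \<open>For \<open>z = 0\<close> any unit vector serves, since only
    \<open>u \<bullet> z = norm z\<close> matters.\<close>
  define u where "u = (if z = 0 then e else (1 / norm z) *\<^sub>R z)"
  have u: "norm u = 1" "u \<bullet> z = norm z"
    using e by (auto simp: u_def dot_square_norm power2_eq_square)
  have *: "(norm x)\<^sup>2 * (\<theta> * cot \<theta>) + 4 * \<theta> * norm z \<le> (L + \<epsilon>) * L" if \<epsilon>: "\<epsilon> > 0" for \<epsilon>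
  proof -
    define K' where "K' = L + \<epsilon>"
    have K': "K' > 0" using L \<epsilon> by (simp add: K'_def)
    \<comment> \<open>the shift by \<open>\<epsilon>\<close> keeps the argument of the cotangent away from its pole at 0\<close>
    define \<phi> where "\<phi> = (\<lambda>s. \<theta> * cot (\<theta> * (s + \<epsilon>) / K'))"
    have "(\<phi> has_real_derivative - (\<theta>\<^sup>2 + (\<phi> s)\<^sup>2) / K') (at s)" if s: "s \<in> {0..L}" for s
    proof -
      define y where "y = \<theta> * (s + \<epsilon>) / K'"
      have "0 < y" using s \<theta> \<epsilon> K' by (simp add: y_def)
      moreover have "y \<le> \<theta>" using s \<theta> K' by (simp add: y_def K'_def divide_le_eq mult_left_mono)
      ultimately have sy: "sin y > 0" using \<theta> sin_gt_zero by simp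
      have "((\<lambda>s. \<theta> * (s + \<epsilon>) / K') has_real_derivative \<theta> / K') (at s)"
        using K' by (auto intro!: derivative_eq_intros)
      moreover have "(cot has_real_derivative - inverse ((sin y)\<^sup>2)) (at y)"
        using sy by (intro DERIV_cot) simp
      ultimately have "((\<lambda>s. cot (\<theta> * (s + \<epsilon>) / K')) has_real_derivative
          - inverse ((sin y)\<^sup>2) * (\<theta> / K')) (at s)"
        unfolding y_def by (rule DERIV_chain2[rotated])
      then have "(\<phi> has_real_derivative \<theta> * (- inverse ((sin y)\<^sup>2) * (\<theta> / K'))) (at s)"
        unfolding \<phi>_def by (rule DERIV_cmult)
      \<comment> \<open>This identity turns the derivative of the cotangent into the Riccati
        equation.\<close>
      moreover have "inverse ((sin y)\<^sup>2) = 1 + (cot y)\<^sup>2"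
        using sy sin_cos_squared_add[of y] by (simp add: cot_def field_simps)
      then have "\<theta> * (- inverse ((sin y)\<^sup>2) * (\<theta> / K')) = - (\<theta>\<^sup>2 + (\<phi> s)\<^sup>2) / K'"
        using K' by (simp add: \<phi>_def y_def power2_eq_square field_simps)
      ultimately show ?thesis by simp
    qed
    from riccati_quadratic_remainder[OF K' L this] obtain M D C where
      M: "\<And>s. s \<in> {0..L} \<Longrightarrow> \<bar>\<phi> s\<bar> \<le> M"
      and D: "\<And>s s'. 0 \<le> s \<Longrightarrow> s \<le> s' \<Longrightarrow> s' \<le> L \<Longrightarrow> \<bar>\<phi> s' - \<phi> s\<bar> \<le> D * (s' - s)"
      and C: "\<And>s s'. 0 \<le> s \<Longrightarrow> s \<le> s' \<Longrightarrow> s' \<le> L \<Longrightarrow>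
        \<phi> s' - \<phi> s + (\<theta>\<^sup>2 + (\<phi> s)\<^sup>2) / K' * (s' - s) \<le> C * (s' - s)\<^sup>2"
      and nonneg: "M \<ge> 0" "D \<ge> 0" "C \<ge> 0" by metis
    \<comment> \<open>\<open>G\<close> starts at 0 and ends at the left side of the claim minus
      \<open>K' * L\<close>.\<close>
    define G where "G = (\<lambda>t. (norm (fst (\<gamma> t)))\<^sup>2 * \<phi> (\<tau> t) + 4 * \<theta> * (u \<bullet> snd (\<gamma> t)) - K' * \<tau> t)"
    have "G 1 \<le> G 0"
    proof (rule decrease_of_quadratic_increment[OF \<tau>(1,2) mono])
      fix a b :: real assume ab: "0 \<le> a" "a \<le> b" "b \<le> 1"
      let ?x = "fst (\<gamma> a)" and ?y = "fst (\<gamma> b) - fst (\<gamma> a)" and ?h = "\<tau> b - \<tau> a"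
      have "(norm (?x + ?y))\<^sup>2 * \<phi> (\<tau> b) - (norm ?x)\<^sup>2 * \<phi> (\<tau> a) + 4 * \<theta> * (u \<bullet> (snd (\<gamma> b) - snd (\<gamma> a)))
          \<le> K' * ?h + (L\<^sup>2 * C + 2 * L * D + M + 4 * \<theta> * K) * ?h\<^sup>2"
        using ab \<theta> \<tau>L[of a] \<tau>L[of b] mono[OF ab] nonneg
        by (intro calibration_increment[OF H u(1) xa dx[OF ab] dz[OF ab] _ K' M D C]) auto
      then show "G b \<le> G a + (L\<^sup>2 * C + 2 * L * D + M + 4 * \<theta> * K) * ?h\<^sup>2"
        by (simp add: G_def inner_diff_right algebra_simps)
    qed
    moreover have "\<phi> L = \<theta> * cot \<theta>" using K' by (simp add: \<phi>_def K'_def)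
    ultimately show ?thesis
      using \<tau> u start end1 by (simp add: G_def K'_def)
  qed
  have "((\<lambda>\<epsilon>. (L + \<epsilon>) * L) \<longlongrightarrow> (L + 0) * L) (at_right 0)"
    by (intro tendsto_intros)
  then have "(norm x)\<^sup>2 * (\<theta> * cot \<theta>) + 4 * \<theta> * norm z \<le> (L + 0) * L"
    using * by (intro tendsto_lowerbound) (auto simp: eventually_at_right_less eventually_at_filter)
  then show "(norm x)\<^sup>2 * (\<theta> * cot \<theta>) + 4 * \<theta> * norm z \<le> (hor_length B \<gamma>)\<^sup>2"
    by (simp add: L_def power2_eq_square)
qed

section \<open>The function \<open>\<nu>\<close>\<close>

lemma nu_eq_cot:
  assumes "sin \<theta> \<noteq> 0"
  shows "nu \<theta> = \<theta> / (sin \<theta>)\<^sup>2 - cot \<theta>"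
proof -
  have "\<theta> \<noteq> 0" using assms by auto
  then have "nu \<theta> = (2 * \<theta> - 2 * sin \<theta> * cos \<theta>) / (2 * (sin \<theta>)\<^sup>2)"
    by (simp add: nu_def sin_double cos_double_sin)
  then show ?thesis
    using assms by (simp add: cot_def field_simps power2_eq_square)
qed

text \<open>Thus \<open>nu \<theta> = 4 * norm z / (norm x)\<^sup>2\<close> says that
  \<open>\<theta>\<close> is a critical point of the lower bound in
  \<open>hor_length_bounds\<close>.\<close>

lemma has_real_derivative_mult_cot:
  assumes "sin \<theta> \<noteq> 0"
  shows "((\<lambda>t. t * cot t) has_real_derivative - nu \<theta>) (at \<theta>)"
  using DERIV_mult[OF DERIV_ident DERIV_cot[OF assms]]
  by (simp add: nu_eq_cot[OF assms] divide_inverse algebra_simps)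

lemma mult_cos_less_sin:
  assumes "0 < \<theta>" "\<theta> < pi"
  shows "\<theta> * cos \<theta> < sin (\<theta>::real)"
proof -
  have "(\<lambda>t. sin t - t * cos t) 0 < (\<lambda>t. sin t - t * cos t) \<theta>"
  proof (rule DERIV_pos_imp_increasing_open[OF assms(1)])
    show "\<exists>y. ((\<lambda>t. sin t - t * cos t) has_real_derivative y) (at t) \<and> 0 < y"
      if "0 < t" "t < \<theta>" for t
      using that assms sin_gt_zero[of t]
      by (intro exI[of _ "t * sin t"]) (auto intro!: derivative_eq_intros)
  qed (intro continuous_intros)
  then show ?thesis by simp
qed

text \<open>The derivative of \<open>nu\<close> is
  \<open>2 * (sin t - t * cos t) / (sin t)^3\<close>, positive by
  \<open>mult_cos_less_sin\<close>.\<close>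

lemma nu_strict_mono:
  assumes "0 < a" "a < b" "b < pi"
  shows "nu a < nu b"
proof -
  have "(\<lambda>t. t / (sin t)\<^sup>2 - cot t) a < (\<lambda>t. t / (sin t)\<^sup>2 - cot t) b"
  proof (rule DERIV_pos_imp_increasing[OF assms(2)])
    fix t assume "a \<le> t" "t \<le> b"
    then have t: "0 < t" "t < pi" and s: "sin t > 0" using assms sin_gt_zero by auto
    have "((\<lambda>t. t / (sin t)\<^sup>2 - cot t) has_real_derivative
        ((sin t)\<^sup>2 - t * (2 * sin t * cos t)) / ((sin t)\<^sup>2)\<^sup>2 + inverse ((sin t)\<^sup>2)) (at t)"
      using s by (auto intro!: derivative_eq_intros DERIV_cot simp: power2_eq_square)
    moreover have "((sin t)\<^sup>2 - t * (2 * sin t * cos t)) / ((sin t)\<^sup>2)\<^sup>2 + inverse ((sin t)\<^sup>2)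
        = 2 * (sin t - t * cos t) / (sin t)^3"
      using s by (simp add: field_simps power2_eq_square power3_eq_cube)
    ultimately show "\<exists>y. ((\<lambda>t. t / (sin t)\<^sup>2 - cot t) has_real_derivative y) (at t) \<and> 0 < y"
      using s mult_cos_less_sin[OF t] by auto
  qed
  moreover have "sin a \<noteq> 0" "sin b \<noteq> 0"
    using assms sin_gt_zero[of a] sin_gt_zero[of b] by auto
  ultimately show ?thesis by (simp add: nu_eq_cot)
qed

lemma ex1_nu_eq:
  assumes "y > 0"
  shows "\<exists>!\<theta>. \<theta> \<in> {0..<pi} \<and> nu \<theta> = y"
proof -
  \<comment> \<open>A solution is never 0, as \<open>nu 0 = 0 < y\<close>; strict monotonicity on
    the open interval then gives uniqueness.\<close>
  have pos: "0 < \<theta>" if "\<theta> \<in> {0..<pi}" "nu \<theta> = y" for \<theta>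
    using that assms by (cases "\<theta> = 0") (auto simp: nu_def)
  \<comment> \<open>Provides a left end point \<open>a > 0\<close> at which \<open>nu\<close> is
    below \<open>y\<close>.\<close>
  have lim: "((\<lambda>t::real. (2 * t - sin (2 * t)) / (1 - cos (2 * t))) \<longlongrightarrow> 0) (at_right 0)"
    by real_asymp
  have "\<forall>\<^sub>F t in at_right 0. t \<in> {0<..<pi} \<and> (2 * t - sin (2 * t)) / (1 - cos (2 * t)) < y"
    using order_tendstoD(2)[OF lim assms] eventually_at_right_real[OF pi_gt_zero]
    by (rule eventually_conj[rotated])
  then obtain a where a: "0 < a" "a < pi" "(2 * a - sin (2 * a)) / (1 - cos (2 * a)) < y"
    using eventually_happens[of _ "at_right (0::real)"] by (auto simp: trivial_limit_at_right_real)
  have c: "1 - cos (2 * t) > 0" if "0 < t" "t < pi" for t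
    using that sin_gt_zero[of t] by (simp add: cos_double_sin)
  \<comment> \<open>The equation \<open>nu t = y\<close> cleared of its denominator:
    \<open>nu\<close> has a pole at \<open>pi\<close>, while \<open>g\<close> is continuous there
    with the positive value \<open>2 * pi\<close>.\<close>
  define g where "g = (\<lambda>t. 2 * t - sin (2 * t) - y * (1 - cos (2 * t)))"
  have "g a \<le> 0" using a c[of a] by (simp add: g_def field_simps)
  moreover have "0 \<le> g pi" by (simp add: g_def)
  moreover have "continuous_on {a..pi} g" unfolding g_def by (intro continuous_intros)
  ultimately obtain \<theta> where \<theta>: "a \<le> \<theta>" "\<theta> \<le> pi" "g \<theta> = 0"
    using IVT'[of g a 0 pi] a by auto
  moreover have "\<theta> \<noteq> pi" using \<theta> by (auto simp: g_def)
  ultimately have "0 < \<theta>" "\<theta> < pi" using a by auto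
  then have "\<theta> \<in> {0..<pi} \<and> nu \<theta> = y"
    using c[of \<theta>] \<theta>(3) by (auto simp: nu_def g_def field_simps)
  then show ?thesis
    using pos nu_strict_mono by (metis atLeastLessThan_iff linorder_neqE_linordered_idom less_irrefl)
qed

section \<open>The distance formula\<close>

lemma cc_dist_eqI:
  assumes "cc_dist B q \<le> ereal c"
    and "\<And>\<gamma>. horizontal_path B \<gamma> \<Longrightarrow> \<gamma> 0 = (0, 0) \<Longrightarrow> \<gamma> 1 = q \<Longrightarrow> c \<le> hor_length B \<gamma>"
  shows "cc_dist B q = ereal c"
  using assms(1)
proof (rule antisym)
  show "ereal c \<le> cc_dist B q"
    unfolding cc_dist_def using assms(2) by (intro INF_greatest) auto
qed

lemma cc_dist_horizontal:
  assumes H: "H_type_group B"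
  shows "cc_dist B (x, 0) = ereal (norm x)"
  using cc_dist_le_segment[OF H] hor_length_bounds(1)[OF H] by (rule cc_dist_eqI)

lemma cc_dist_vertical:
  assumes H: "H_type_group B"
  shows "cc_dist B (0, z) = ereal (sqrt (4 * pi * norm z))"
proof (cases "z = 0")
  case True
  then show ?thesis using cc_dist_horizontal[OF H, of 0] by simp
next
  case z: False
  show ?thesis
  proof (rule cc_dist_eqI)
    obtain p :: "real^'a" where p: "norm p = 1" using vector_choose_size[of 1] by auto
    define u where "u = (1 / norm z) *\<^sub>R z"
    \<comment> \<open>A full circle of diameter \<open>r\<close> has area
      \<open>pi * r\<^sup>2 / 4\<close>, which must equal \<open>norm z\<close>; its initial
      direction \<open>p\<close> is arbitrary.\<close>
    define r where "r = sqrt (4 * norm z / pi)"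
    have u: "norm u = 1" "norm z *\<^sub>R u = z" using z by (auto simp: u_def)
    have "r * pi = sqrt (4 * norm z / pi) * sqrt (pi\<^sup>2)" by (simp add: r_def)
    also have "\<dots> = sqrt (4 * pi * norm z)"
      unfolding real_sqrt_mult[symmetric] by (simp add: power2_eq_square)
    finally have "r * pi = sqrt (4 * pi * norm z)" .
    moreover have "r\<^sup>2 / 8 * (2 * pi - sin (2 * pi)) = norm z" by (simp add: r_def)
    moreover have "r \<ge> 0" by (simp add: r_def)
    ultimately show "cc_dist B (0, z) \<le> ereal (sqrt (4 * pi * norm z))"
      using cc_dist_le_arc[OF H p u(1), of r pi] u(2) by simp
  next
    fix \<gamma> assume \<gamma>: "horizontal_path B \<gamma>" "\<gamma> 0 = (0, 0)" "\<gamma> 1 = (0, z)"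
    \<comment> \<open>With \<open>x = 0\<close> the cotangent term is absent, so the lower bound has
      a limit as \<open>\<theta>\<close> approaches \<open>pi\<close>.\<close>
    have "((\<lambda>\<theta>. 4 * \<theta> * norm z) \<longlongrightarrow> 4 * pi * norm z) (at_left pi)"
      by (intro tendsto_intros)
    moreover have "\<forall>\<^sub>F \<theta> in at_left pi. 4 * \<theta> * norm z \<le> (hor_length B \<gamma>)\<^sup>2"
      using eventually_at_left_real[OF pi_gt_zero]
      by eventually_elim (use hor_length_bounds(2)[OF H \<gamma>] in auto)
    ultimately have "4 * pi * norm z \<le> (hor_length B \<gamma>)\<^sup>2"
      by (rule tendsto_upperbound) simp
    then show "sqrt (4 * pi * norm z) \<le> hor_length B \<gamma>"
      using hor_length_bounds(1)[OF H \<gamma>] by (intro real_le_lsqrt) auto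
  qed
qed

lemma cc_dist_general:
  assumes H: "H_type_group B" and x: "x \<noteq> 0" and z: "z \<noteq> 0" and \<theta>: "0 \<le> \<theta>" "\<theta> < pi"
    and nu: "nu \<theta> = 4 * norm z / (norm x)\<^sup>2"
  shows "cc_dist B (x, z) = ereal (norm x * (\<theta> / sin \<theta>))"
proof (rule cc_dist_eqI)
  have \<theta>0: "0 < \<theta>" using \<theta> nu x z by (cases "\<theta> = 0") (auto simp: nu_def)
  then have s: "sin \<theta> > 0" using \<theta> sin_gt_zero by blast
  have nz: "norm z = (norm x)\<^sup>2 * nu \<theta> / 4" using nu x by simp
  define u where "u = (1 / norm z) *\<^sub>R z"
  have u: "norm u = 1" "norm z *\<^sub>R u = z" using z by (auto simp: u_def)
  define e where "e = (1 / norm x) *\<^sub>R x"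
  have e: "norm e = 1" "norm x *\<^sub>R e = x" using x by (auto simp: e_def)
  \<comment> \<open>The direction of \<open>x\<close> rotated back by \<open>\<theta>\<close>, so
    that the chord of the arc points along \<open>x\<close>; \<open>r\<close> then fits the chord
    length.\<close>
  define p where "p = cos \<theta> *\<^sub>R e + (- sin \<theta>) *\<^sub>R J_hor B u e"
  define r where "r = norm x / sin \<theta>"
  have "J_hor B u p = cos \<theta> *\<^sub>R J_hor B u e + sin \<theta> *\<^sub>R e"
    unfolding p_def J_hor_lin_comb[OF H] J_hor_J_hor[OF H u(1)] by simp
  moreover have "c *\<^sub>R (c *\<^sub>R e + (- d) *\<^sub>R f) + d *\<^sub>R (c *\<^sub>R f + d *\<^sub>R e) = (c\<^sup>2 + d\<^sup>2) *\<^sub>R e" for c d f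
    by (simp add: algebra_simps power2_eq_square)
  ultimately have "cos \<theta> *\<^sub>R p + sin \<theta> *\<^sub>R J_hor B u p = ((cos \<theta>)\<^sup>2 + (sin \<theta>)\<^sup>2) *\<^sub>R e"
    by (simp only: p_def)
  then have pe: "cos \<theta> *\<^sub>R p + sin \<theta> *\<^sub>R J_hor B u p = e" by simp
  have "p \<bullet> p = (cos \<theta>)\<^sup>2 * (e \<bullet> e) + (sin \<theta>)\<^sup>2 * (J_hor B u e \<bullet> J_hor B u e)"
    using J_hor_self[OF H, of u e]
    by (simp add: p_def inner_diff_left inner_diff_right inner_commute power2_eq_square algebra_simps)
  also have "\<dots> = 1"
    unfolding J_hor_orthogonal[OF H u(1)] using e(1) by (simp add: dot_square_norm)
  finally have p: "norm p = 1" by (simp add: norm_eq_1)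
  have "r\<^sup>2 / 8 * (2 * \<theta> - sin (2 * \<theta>)) = norm z"
    unfolding sin_double
    using s by (simp add: nz nu_eq_cot r_def cot_def power2_eq_square field_simps)
  moreover have "(r * sin \<theta>) *\<^sub>R e = x" using s e(2) by (simp add: r_def)
  moreover have "r \<ge> 0" using s by (simp add: r_def)
  ultimately show "cc_dist B (x, z) \<le> ereal (norm x * (\<theta> / sin \<theta>))"
    using cc_dist_le_arc[OF H p u(1), of r \<theta>] u(2) \<theta>0 by (simp add: pe) (simp add: r_def)
  fix \<gamma> assume \<gamma>: "horizontal_path B \<gamma>" "\<gamma> 0 = (0, 0)" "\<gamma> 1 = (x, z)"
  \<comment> \<open>Equality of the bounds: \<open>\<theta> * cot \<theta> + \<theta> * nu \<theta>
    = (\<theta> / sin \<theta>)\<^sup>2\<close>.\<close>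
  have "(norm x * (\<theta> / sin \<theta>))\<^sup>2 = (norm x)\<^sup>2 * (\<theta> * cot \<theta>) + 4 * \<theta> * norm z"
    using s by (simp add: nz nu_eq_cot power2_eq_square field_simps)
  also have "\<dots> \<le> (hor_length B \<gamma>)\<^sup>2"
    by (rule hor_length_bounds(2)[OF H \<gamma> \<theta>0 \<theta>(2)])
  finally show "norm x * (\<theta> / sin \<theta>) \<le> hor_length B \<gamma>"
    using hor_length_bounds(1)[OF H \<gamma>] norm_ge_zero[of x] by (meson order_trans power2_le_imp_le)
qed

theorem theorem3p5:
  fixes B :: "real^'p \<Rightarrow> real^'p \<Rightarrow> real^'m"
    and n :: nat
    and x :: "real^'p"
    and z :: "real^'m"
  assumes "CARD('p) = 2 * n"
    and "H_type_group B"
  shows "(\<forall>\<theta>. sin \<theta> \<noteq> 0 \<longrightarrow>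
            nu \<theta> = \<theta> / (sin \<theta>)^2 - cot \<theta> \<and>
            ((\<lambda>t. t * cot t) has_real_derivative - nu \<theta>) (at \<theta>)) \<and>
         (z \<noteq> 0 \<and> x \<noteq> 0 \<longrightarrow>
            (\<exists>!\<theta>. \<theta> \<in> {0..<pi} \<and> nu \<theta> = 4 * norm z / (norm x)^2) \<and>
            (\<forall>\<theta>\<in>{0..<pi}. nu \<theta> = 4 * norm z / (norm x)^2 \<longrightarrow>
               cc_dist B (x, z) = ereal (norm x * (\<theta> / sin \<theta>)))) \<and>
         (z = 0 \<longrightarrow> cc_dist B (x, z) = ereal (norm x)) \<and>
         (x = 0 \<longrightarrow> cc_dist B (x, z) = ereal (sqrt (4 * pi * norm z)))"
  using assms nu_eq_cot has_real_derivative_mult_cot ex1_nu_eq[of "4 * norm z / (norm x)\<^sup>2"]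
    cc_dist_general[OF assms(2), of x z] cc_dist_horizontal[OF assms(2), of x]
    cc_dist_vertical[OF assms(2), of z]
  by auto

end
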